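(* For $0<\lambda<1$, let $\nu_\lambda$ be the $\lambda$-Bernoulli convolution on $\mathbb{R}$, with support denoted by $K$. If $\nu_\lambda$ is absolutely continuous with respect to Lebesgue measure and $\lambda\ne 1/2$, then $L^2(K,d\nu_\lambda)$ does not admit any Fourier frame. In particular, for Lebesgue-almost every $\lambda\in(1/2,1)$, $L^2(K,d\nu_\lambda)$ does not admit any Fourier frame.
   Context: The $\lambda$-Bernoulli convolution $\nu_\lambda$ is the unique Borel probability measure on $\mathbb{R}$ satisfying $\nu_\lambda(E)=\frac12\nu_\lambda(f_1^{-1}(E))+\frac12\nu_\lambda(f_2^{-1}(E))$ for all Borel sets $E$, where $f_1(x)=\lambda x$ and $f_2(x)=\lambda x+1-\lambda$. For a compactly supported probability measure $\mu$ on $\mathbb{R}$ with support $K$, $L^2(K,d\mu)$ admits a Fourier frame if there are a countable set $\Lambda\subset\mathbb{R}$ and constants $0<A\le B<\infty$ such that $$A\int|f|^2d\mu\le\sum_{\xi\in\Lambda}\Big|\int f(x)e^{-2\pi i\xi x}d\mu(x)\Big|^2\le B\int|f|^2d\mu$$ for all $f\in L^2(K,d\mu)$. *)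

theory Defs
  imports "HOL-Probability.Probability" "HOL-Probability.Stream_Space"
begin

definition is_bernoulli_convolution :: "real \<Rightarrow> real measure \<Rightarrow> bool" where
  "is_bernoulli_convolution l M \<longleftrightarrow>
     prob_space M \<and> sets M = sets borel \<and>
     (\<forall>E\<in>sets borel. measure M E =
        1/2 * measure M ((\<lambda>x. l * x) -` E) + 1/2 * measure M ((\<lambda>x. l * x + 1 - l) -` E))"

definition bernoulli_convolution :: "real \<Rightarrow> real measure" where
  "bernoulli_convolution l = (THE M. is_bernoulli_convolution l M)"

definition measure_support :: "'a::topological_space measure \<Rightarrow> 'a set" where
  "measure_support M = {x. \<forall>U. open U \<longrightarrow> x \<in> U \<longrightarrow> emeasure M U > 0}"

(* Square-integrable functions on K; they are representatives, not classes modulo null sets.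
   Values outside K are irrelevant: both conditions only look at the restriction of f to K. *)
definition L2_functions :: "real set \<Rightarrow> real measure \<Rightarrow> (real \<Rightarrow> complex) set" where
  "L2_functions K M =
     {f. f \<in> borel_measurable (restrict_space M K) \<and>
         integrable (restrict_space M K) (\<lambda>x. (cmod (f x))\<^sup>2)}"

definition fourier_coefficient :: "real set \<Rightarrow> real measure \<Rightarrow> (real \<Rightarrow> complex) \<Rightarrow> real \<Rightarrow> complex" where
  "fourier_coefficient K M f \<xi> =
     (LINT x|restrict_space M K. f x * exp (- 2 * of_real pi * \<i> * of_real \<xi> * of_real x))"

(* The sum over the frequencies is taken in the extended nonnegative reals, so it always exists,
   and the upper bound includes its convergence. *)
definition is_fourier_frame :: "real set \<Rightarrow> real measure \<Rightarrow> real set \<Rightarrow> bool" where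
  "is_fourier_frame K M \<Lambda> \<longleftrightarrow>
     (\<exists>A B :: real. 0 < A \<and> A \<le> B \<and>
        (\<forall>f\<in>L2_functions K M.
           ennreal (A * (LINT x|restrict_space M K. (cmod (f x))\<^sup>2))
             \<le> (\<Sum>\<^sub>\<infinity>\<xi>\<in>\<Lambda>. ennreal ((cmod (fourier_coefficient K M f \<xi>))\<^sup>2)) \<and>
           (\<Sum>\<^sub>\<infinity>\<xi>\<in>\<Lambda>. ennreal ((cmod (fourier_coefficient K M f \<xi>))\<^sup>2))
             \<le> ennreal (B * (LINT x|restrict_space M K. (cmod (f x))\<^sup>2))))"

(* The space is L^2(K, dM) with K the support of M, which is closed and hence a Borel set. *)
definition admits_fourier_frame :: "real measure \<Rightarrow> bool" where
  "admits_fourier_frame M \<longleftrightarrow>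
     (\<exists>\<Lambda> :: real set. countable \<Lambda> \<and> is_fourier_frame (measure_support M) M \<Lambda>)"


subsection \<open>Existence and uniqueness of the Bernoulli convolution\<close>

lemma ennreal_average:
  "0 \<le> a \<Longrightarrow> 0 \<le> b \<Longrightarrow>
    ennreal a * ennreal (1/2) + ennreal b * ennreal (1/2) = ennreal (1/2 * a + 1/2 * b)"
  by (subst ennreal_mult[symmetric], simp, simp)+ (simp add: mult.commute flip: ennreal_plus)

lemma char_bernoulli_convolution:
  assumes M: "is_bernoulli_convolution l M"
  shows "char M t = (1 + iexp (t * (1 - l))) / 2 * char M (l * t)"
proof -
  interpret M: prob_space M using M by (simp add: is_bernoulli_convolution_def)
  have sM [measurable_cong]: "sets M = sets borel"
    using M by (simp add: is_bernoulli_convolution_def)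
  have spM: "space M = UNIV" using sets_eq_imp_space_eq[OF sM] by simp
  let ?P = "measure_pmf (bernoulli_pmf (1/2))"
  let ?g = "\<lambda>(b, x). if b then l * x else l * x + 1 - l"
    interpret PM: pair_prob_space ?P M ..
  have g [measurable]: "?g \<in> borel_measurable (?P \<Otimes>\<^sub>M M)" by measurable
  have eq: "M = distr (?P \<Otimes>\<^sub>M M) borel ?g"
  proof (rule measure_eqI)
    fix E assume E: "E \<in> sets M"
    then have Eb [measurable]: "E \<in> sets borel" by (simp add: sM)
    have "emeasure (distr (?P \<Otimes>\<^sub>M M) borel ?g) E = emeasure (?P \<Otimes>\<^sub>M M) (?g -` E \<inter> space (?P \<Otimes>\<^sub>M M))"
      by (simp add: emeasure_distr)
    also have "\<dots> = (\<integral>\<^sup>+b. emeasure M (Pair b -` (?g -` E \<inter> space (?P \<Otimes>\<^sub>M M))) \<partial>?P)"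
      by (rule M.emeasure_pair_measure_alt) measurable
    also have "\<dots> = emeasure M ((\<lambda>x. l * x) -` E) * ennreal (1/2)
        + emeasure M ((\<lambda>x. l * x + 1 - l) -` E) * ennreal (1/2)"
      by (subst nn_integral_bernoulli_pmf) (auto simp: vimage_def space_pair_measure spM)
    also have "\<dots> = ennreal (measure M E)"
      using M Eb unfolding is_bernoulli_convolution_def M.emeasure_eq_measure
      by (subst ennreal_average) auto
    finally show "emeasure M E = emeasure (distr (?P \<Otimes>\<^sub>M M) borel ?g) E"
      by (simp add: M.emeasure_eq_measure)
  qed (simp add: sM)
  have "char M t = (CLINT z|(?P \<Otimes>\<^sub>M M). iexp (t * ?g z))"
    by (subst eq, unfold char_def, subst integral_distr) auto
  also have "\<dots> = (CLINT b|?P. CLINT x|M. iexp (t * ?g (b, x)))"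
    by (rule PM.integral_fst'[symmetric], rule PM.integrable_const_bound[where B = 1]) auto
  also have "\<dots> = ((CLINT x|M. iexp (t * (l * x))) + (CLINT x|M. iexp (t * (l * x + 1 - l)))) / 2"
    by (subst integral_measure_pmf[of UNIV]) (auto simp: UNIV_bool scaleR_conv_of_real field_simps)
  also have "(CLINT x|M. iexp (t * (l * x + 1 - l))) =
      (CLINT x|M. iexp (t * (1 - l)) * iexp (l * t * x))"
    by (intro Bochner_Integration.integral_cong refl) (simp add: exp_add[symmetric] algebra_simps)
  also have "\<dots> = iexp (t * (1 - l)) * char M (l * t)"
    by (simp add: char_def)
  finally show ?thesis by (simp add: char_def algebra_simps add_divide_distrib)
qed

lemma is_bernoulli_convolution_unique:
  assumes l: "0 < l" "l < 1"
    and M: "is_bernoulli_convolution l M" and N: "is_bernoulli_convolution l N"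
  shows "M = N"
proof -
  have MN: "real_distribution M" "real_distribution N"
    using M N
    by (auto simp: is_bernoulli_convolution_def real_distribution_def real_distribution_axioms_def
        dest: sets_eq_imp_space_eq)
  define d where "d t = char M t - char N t" for t
  have step: "cmod (d t) \<le> cmod (d (l * t))" for t
  proof -
    have "cmod (1 + iexp (t * (1 - l))) \<le> 1 + 1"
      by (rule order_trans[OF norm_triangle_ineq]) simp
    then have "cmod ((1 + iexp (t * (1 - l))) / 2) \<le> 1" by (simp add: norm_divide)
    moreover have "d t = (1 + iexp (t * (1 - l))) / 2 * d (l * t)"
      unfolding d_def
      by (simp only: char_bernoulli_convolution[OF M, of t] char_bernoulli_convolution[OF N, of t]
          right_diff_distrib)
    ultimately show ?thesis
      by (simp only: norm_mult) (rule mult_left_le_one_le, auto)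
  qed
  have iter: "cmod (d t) \<le> cmod (d (l ^ n * t))" for n t
  proof (induction n)
    case (Suc n)
    then show ?case using step[of "l ^ n * t"] by (simp add: mult.assoc)
  qed simp
  have "d t = 0" for t
  proof -
    have "isCont d 0" unfolding d_def
      using MN by (intro continuous_intros real_distribution.isCont_char) auto
    moreover have "(\<lambda>n. l ^ n * t) \<longlonglongrightarrow> 0"
      using l by (intro tendsto_mult_left_zero LIMSEQ_power_zero) auto
    ultimately have "(\<lambda>n. d (l ^ n * t)) \<longlonglongrightarrow> d 0" by (rule isCont_tendsto_compose)
    moreover have "d 0 = 0"
      using MN by (simp add: d_def real_distribution.char_zero)
    ultimately have "(\<lambda>n. cmod (d (l ^ n * t))) \<longlonglongrightarrow> 0"
      using tendsto_norm_zero_iff by metis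
    then have "cmod (d t) \<le> 0"
      by (rule LIMSEQ_le_const) (use iter in auto)
    then show ?thesis by simp
  qed
  then have "char M = char N" by (auto simp: d_def)
  then show ?thesis using Levy_uniqueness MN by blast
qed

lemma is_bernoulli_convolution_exists:
  assumes l: "0 < l" "l < 1"
  shows "\<exists>M. is_bernoulli_convolution l M"
proof -
  let ?P = "measure_pmf (bernoulli_pmf (1/2))"
  let ?S = "stream_space ?P"
  interpret S: prob_space ?S by (rule prob_space.prob_space_stream_space[OF measure_pmf.prob_space_axioms])
  define c :: "bool \<Rightarrow> real" where "c b = (if b then 0 else 1 - l)" for b
  define X where "X s = (\<Sum>n. l ^ n * c (s !! n))" for s
  have summ: "summable (\<lambda>n. l ^ n * c (s !! n))" for s
    by (rule summable_comparison_test'[where g = "\<lambda>n. l ^ n" and N = 0])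
      (use l in \<open>auto simp: c_def intro!: mult_left_le\<close>)
  have X_Cons: "X (b ## s) = c b + l * X s" for b s
  proof -
    have "X (b ## s) = c b + (\<Sum>n. l ^ Suc n * c (s !! n))"
      unfolding X_def using suminf_split_head[OF summ[of "b ## s"]] by simp
    also have "(\<Sum>n. l ^ Suc n * c (s !! n)) = l * X s"
      unfolding X_def by (subst suminf_mult[OF summ, symmetric]) (simp add: mult.assoc)
    finally show ?thesis .
  qed
  have [measurable]: "X \<in> borel_measurable ?S" unfolding X_def by measurable
  let ?M = "distr ?S borel X"
  interpret M: prob_space ?M by (rule S.prob_space_distr) simp
  have "measure ?M E = 1/2 * measure ?M ((\<lambda>x. l * x) -` E) + 1/2 * measure ?M ((\<lambda>x. l * x + 1 - l) -` E)"
    if [measurable]: "E \<in> sets borel" for E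
  proof -
    have *: "(\<lambda>x. l * x) -` E \<in> sets borel" "(\<lambda>x. l * x + 1 - l) -` E \<in> sets borel"
      using that by (auto intro!: measurable_sets_borel[of _ borel])
    have "emeasure ?M E = emeasure ?S (X -` E \<inter> space ?S)"
      by (simp add: emeasure_distr)
    also have "\<dots> = (\<integral>\<^sup>+b. emeasure ?S {s \<in> space ?S. b ## s \<in> X -` E \<inter> space ?S} \<partial>?P)"
      by (rule prob_space.emeasure_stream_space[OF measure_pmf.prob_space_axioms]) measurable
    also have "\<dots> = (\<integral>\<^sup>+b. emeasure ?S ((if b then X -` ((\<lambda>x. l * x) -` E) else X -` ((\<lambda>x. l * x + 1 - l) -` E)) \<inter> space ?S) \<partial>?P)"
      by (intro nn_integral_cong arg_cong[where f = "emeasure ?S"])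
        (auto simp: X_Cons space_stream_space c_def algebra_simps)
    also have "\<dots> = emeasure ?M ((\<lambda>x. l * x) -` E) * ennreal (1/2)
        + emeasure ?M ((\<lambda>x. l * x + 1 - l) -` E) * ennreal (1/2)"
      using * by (subst nn_integral_bernoulli_pmf) (auto simp: emeasure_distr)
    finally show ?thesis
      unfolding M.emeasure_eq_measure
      by (subst (asm) ennreal_average) (auto simp del: ennreal_plus)
  qed
  then have "is_bernoulli_convolution l ?M"
    by (simp add: is_bernoulli_convolution_def M.prob_space_axioms)
  then show ?thesis ..
qed

lemma bernoulli_convolution:
  assumes "0 < l" "l < 1"
  shows "is_bernoulli_convolution l (bernoulli_convolution l)"
  unfolding bernoulli_convolution_def
  using is_bernoulli_convolution_exists[OF assms] is_bernoulli_convolution_unique[OF assms]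
  by (metis theI)

end

theory Submission
  imports Defs
begin

text \<open>
  Two facts about a Bernoulli convolution with parameter \<open>l\<close> are combined: if it is absolutely
  continuous and \<open>l \<noteq> 1/2\<close> it has no Fourier frame, and it is absolutely continuous for almost every
  \<open>l\<close> in \<open>(1/2, 1)\<close> (Solomyak's theorem).

  \<^emph>\<open>No frame.\<close> Lebesgue measure on a set \<open>F\<close> is an average of translates of measures \<open>f M\<close> with
  \<open>f\<close> bounded, and translating a measure does not change the moduli of its Fourier coefficients.
  So the upper frame bound for \<open>M\<close> implies an upper bound of the same kind for Lebesgue measure
  (\<open>bessel_lebesgue\<close>). If \<open>M\<close> has density \<open>D\<close>, the function \<open>1 / D\<close> on \<open>F\<close> turns \<open>M\<close> into Lebesgue
  measure on \<open>F\<close>, and the lower frame bound then prevents \<open>D\<close> from being small on a set where it is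
  positive. But it is small near \<open>0\<close>: only the map \<open>x \<mapsto> l x\<close> reaches the interval \<open>[0, 1 - l)\<close>, so that
  \<open>M\<close> scales by \<open>1/2\<close> under this map (\<open>integral_self_similar\<close>) whereas Lebesgue measure scales by
  \<open>l\<close>. For \<open>l > 1/2\<close> the density at scale \<open>l ^ n\<close> is therefore of order \<open>(2 l) ^ (- n)\<close>, a contradiction
  (\<open>not_admits_fourier_frame\<close>). For \<open>l < 1/2\<close> the measure lives on a Lebesgue null set.

  \<^emph>\<open>Absolute continuity.\<close> The squared modulus of the characteristic function is dominated by
  the products of the functions \<open>cos\<^sup>2 (l ^ n t)\<close>. If their limit is integrable in \<open>t\<close>, then \<open>M\<close> has an
  \<open>L\<^sup>2\<close> density (\<open>absolutely_continuous_if_char_square_integrable\<close>). Integrability for almost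
  every \<open>l\<close> follows by averaging over \<open>l\<close>. Expanding the product of the \<open>cos\<^sup>2\<close> gives the cosines
  \<open>cos (2 t l ^ k g l)\<close>, where \<open>g\<close> is a polynomial with coefficients in \<open>{-1, 0, 1}\<close> and constant
  coefficient \<open>1\<close>. Such a polynomial is transversal: it vanishes at most once on the parameter interval and
  grows linearly away from its zero (\<open>transversality\<close>), so that the average of the cosine over \<open>l\<close> decays like
  \<open>1 / (t l ^ k)\<close> at scale \<open>t\<close>. The pairs of digit sequences that first differ at place \<open>k\<close> have weight about
  \<open>2 ^ (- k)\<close>, and the sum over \<open>k\<close> converges because \<open>l > 1/2\<close>.

  Transversality for all digits is available up to \<open>16/25\<close>. Between \<open>16/25\<close> and \<open>442/625\<close> it is restored by
  using only two digits out of three, which is still enough for convergence there. Since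
  \<open>442/625\<close> exceeds the square root of \<open>1/2\<close>, repeated squaring brings every
  \<open>l\<close> in \<open>(1/2, 1)\<close> into the range covered, and squaring the parameter amounts to omitting every
  second factor of the product.
\<close>

section \<open>Transversality of polynomials with bounded coefficients\<close>

text \<open>
  A zero of \<open>G\<close> serves as \<open>z\<close>; if \<open>G\<close> does not change sign, an endpoint of the interval does. Having a
  point \<open>z\<close> in all cases makes a case distinction unnecessary later.
\<close>
lemma exists_separating_point:
  fixes G :: "real \<Rightarrow> real"
  assumes ab: "a \<le> b" and c: "0 \<le> c" and cont: "continuous_on {a..b} G"
    and dec: "\<And>x y. a \<le> x \<Longrightarrow> x \<le> y \<Longrightarrow> y \<le> b \<Longrightarrow> G y - G x \<le> - c * (y - x)"
  shows "\<exists>z. \<forall>x\<in>{a..b}. c * \<bar>x - z\<bar> \<le> \<bar>G x\<bar>"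
proof -
  consider "G a \<le> 0" | "G b \<ge> 0" | "G a > 0" "G b < 0" by linarith
  then show ?thesis
  proof cases
    case 1
    have "c * \<bar>x - a\<bar> \<le> \<bar>G x\<bar>" if "x \<in> {a..b}" for x
      using dec[of a x] that 1 by auto
    then show ?thesis by blast
  next
    case 2
    have "c * \<bar>x - b\<bar> \<le> \<bar>G x\<bar>" if "x \<in> {a..b}" for x
    proof -
      have "G b - G x \<le> - (c * (b - x))" using dec[of x b] that by auto
      then have "c * (b - x) \<le> G x" using 2 by simp
      then show ?thesis using that abs_ge_self[of "G x"] by (simp add: abs_minus_commute)
    qed
    then show ?thesis by blast
  next
    case 3
    then obtain z where z: "a \<le> z" "z \<le> b" "G z = 0"
      using IVT2'[of G b 0 a] ab cont by auto
    have "c * \<bar>x - z\<bar> \<le> \<bar>G x\<bar>" if "x \<in> {a..b}" for x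
      using dec[of x z] dec[of z x] that z by (cases "x \<le> z") (auto simp: abs_if algebra_simps)
    then show ?thesis by blast
  qed
qed

text \<open>
  For \<open>g x = (\<Sum>i<M. d i * x ^ i)\<close> the combination \<open>x g'(x) - 4 g(x)\<close> has the coefficients \<open>(i - 4) d i\<close>, with
  constant term \<open>-4\<close>. The hypothesis says that the other terms cannot compensate for more than
  \<open>4 - \<eta>\<close> of it, even at the right end of the interval. So the combination is at most \<open>- \<eta>\<close> throughout, which means that
  \<open>g x / x ^ 4\<close> decreases with slope at most \<open>- \<eta>\<close>. Any positive number could replace \<open>4\<close> in this argument; \<open>4\<close> is a
  value for which the hypothesis holds on the two intervals used below.
\<close>
lemma transversality:
  fixes d w :: "nat \<Rightarrow> real"
  assumes a: "0 < a" and b: "b < 1" and \<eta>: "0 \<le> \<eta>"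
    and d0: "d 0 = 1" and d: "\<And>i. 0 < i \<Longrightarrow> i < M \<Longrightarrow> \<bar>d i\<bar> \<le> w i" and M: "0 < M"
    and sum: "(\<Sum>i = 1..<M. \<bar>real i - 4\<bar> * w i * b ^ i) \<le> 4 - \<eta>"
  shows "\<exists>z. \<forall>x\<in>{a..b}. a ^ 4 * \<eta> * \<bar>x - z\<bar> \<le> \<bar>\<Sum>i<M. d i * x ^ i\<bar>"
proof (cases "a \<le> b")
  case True
  define g where "g x = (\<Sum>i<M. d i * x ^ i)" for x
  define g' where "g' x = (\<Sum>i<M. d i * (real i * x ^ (i - 1)))" for x
  define G where "G x = g x / x ^ 4" for x
  have g': "(g has_real_derivative g' x) (at x)" for x
    unfolding g_def g'_def by (auto intro!: derivative_eq_intros sum.cong)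
  have key: "x * g' x - 4 * g x \<le> - \<eta>" if x: "a \<le> x" "x \<le> b" for x
  proof -
    have "x * g' x - 4 * g x = (\<Sum>i<M. d i * ((real i - 4) * x ^ i))"
      unfolding g_def g'_def sum_distrib_left sum_subtractf[symmetric]
    proof (rule sum.cong[OF refl])
      fix i show "x * (d i * (real i * x ^ (i - 1))) - 4 * (d i * x ^ i) = d i * ((real i - 4) * x ^ i)"
        by (cases i) (auto simp: algebra_simps)
    qed
    also have "\<dots> = - 4 + (\<Sum>i = 1..<M. d i * ((real i - 4) * x ^ i))"
      using sum.atLeast_Suc_lessThan[OF M, of "\<lambda>i. d i * ((real i - 4) * x ^ i)"] d0
      by (simp add: lessThan_atLeast0)
    also have "(\<Sum>i = 1..<M. d i * ((real i - 4) * x ^ i)) \<le> (\<Sum>i = 1..<M. \<bar>real i - 4\<bar> * w i * b ^ i)"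
    proof (rule sum_mono)
      fix i assume i: "i \<in> {1..<M}"
      have "d i * ((real i - 4) * x ^ i) \<le> \<bar>d i\<bar> * (\<bar>real i - 4\<bar> * x ^ i)"
        using a x abs_ge_self[of "d i * ((real i - 4) * x ^ i)"] by (simp add: abs_mult)
      also have "\<dots> \<le> w i * (\<bar>real i - 4\<bar> * b ^ i)"
        using d[of i] i a x by (intro mult_mono mult_left_mono power_mono) auto
      finally show "d i * ((real i - 4) * x ^ i) \<le> \<bar>real i - 4\<bar> * w i * b ^ i"
        by (simp add: ac_simps)
    qed
    also note sum
    finally show ?thesis by simp
  qed
  have G': "(G has_real_derivative (x * g' x - 4 * g x) / x ^ 5) (at x)" if "a \<le> x" for x
  proof -
    have "(G has_real_derivative (g' x * x ^ 4 - g x * (4 * x ^ 3)) / (x ^ 4 * x ^ 4)) (at x)"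
      unfolding G_def using a that
      by (intro DERIV_divide g' DERIV_pow[of 4, simplified]) auto
    moreover have "(g' x * x ^ 4 - g x * (4 * x ^ 3)) / (x ^ 4 * x ^ 4) = (x * g' x - 4 * g x) / x ^ 5"
      using a that by (simp add: field_simps) (simp add: algebra_simps eval_nat_numeral)
    ultimately show ?thesis by simp
  qed
  have G'le: "(x * g' x - 4 * g x) / x ^ 5 \<le> - \<eta>" if x: "a \<le> x" "x \<le> b" for x
  proof -
    have "0 < x ^ 5" "x ^ 5 \<le> 1" using a b x by (auto intro!: power_le_one)
    then have "\<eta> * x ^ 5 \<le> \<eta>" using \<eta> by (intro mult_left_le) auto
    with key[OF x] \<open>0 < x ^ 5\<close> show ?thesis by (simp add: field_simps)
  qed
  have "\<exists>z. \<forall>x\<in>{a..b}. \<eta> * \<bar>x - z\<bar> \<le> \<bar>G x\<bar>"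
  proof (rule exists_separating_point[OF True \<eta>])
    show "continuous_on {a..b} G"
      by (rule DERIV_continuous_on[OF has_field_derivative_at_within[OF G']]) auto
    fix x y assume xy: "a \<le> x" "x \<le> y" "y \<le> b"
    have "G y + \<eta> * y \<le> G x + \<eta> * x"
    proof (rule DERIV_nonpos_imp_nonincreasing[OF xy(2)])
      fix u assume "x \<le> u" "u \<le> y"
      then show "\<exists>D. ((\<lambda>u. G u + \<eta> * u) has_real_derivative D) (at u) \<and> D \<le> 0"
        using G'[of u] G'le[of u] xy
        by (intro exI[of _ "(u * g' u - 4 * g u) / u ^ 5 + \<eta>"]) (auto intro!: derivative_eq_intros)
    qed
    then show "G y - G x \<le> - \<eta> * (y - x)" by (simp add: algebra_simps)
  qed
  then obtain z where z: "\<And>x. x \<in> {a..b} \<Longrightarrow> \<eta> * \<bar>x - z\<bar> \<le> \<bar>G x\<bar>" by blast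
  have "a ^ 4 * \<eta> * \<bar>x - z\<bar> \<le> \<bar>g x\<bar>" if x: "x \<in> {a..b}" for x
  proof -
    have "a ^ 4 * \<eta> * \<bar>x - z\<bar> \<le> x ^ 4 * (\<eta> * \<bar>x - z\<bar>)"
      using x a \<eta> by (simp add: mult.assoc) (intro mult_right_mono power_mono, auto)
    also have "\<dots> \<le> x ^ 4 * \<bar>G x\<bar>" using z[OF x] by (intro mult_left_mono) auto
    also have "\<dots> = \<bar>g x\<bar>" using x a by (simp add: G_def abs_divide)
    finally show ?thesis .
  qed
  then show ?thesis unfolding g_def by blast
qed auto

section \<open>Averages of cosine products over the parameter\<close>

lemma gauss_cos_integral:
  "(LINT s|std_normal_distribution. cos (u * s)) = exp (- (u\<^sup>2) / 2)"
proof -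
  interpret real_distribution std_normal_distribution by (rule real_dist_normal_dist)
  have "exp (- (u\<^sup>2) / 2) = Re (char std_normal_distribution u)"
    by (simp add: char_std_normal_distribution)
  also have "\<dots> = (LINT s|std_normal_distribution. Re (iexp (u * s)))"
    unfolding char_def by (rule integral_Re[symmetric], rule integrable_const_bound[where B=1]) auto
  finally show ?thesis by (simp add: cos_of_real flip: Re_exp) (simp add: Re_exp)
qed

lemma gauss_translate_nn_integral:
  assumes "0 < k"
  shows "(\<integral>\<^sup>+x. ennreal (exp (- (k * (x - z))\<^sup>2 / 2)) \<partial>lborel) = ennreal (sqrt (2 * pi) / k)"
proof -
  have eq: "exp (- (k * (x - z))\<^sup>2 / 2) = (sqrt (2 * pi) / k) * normal_density z (1 / k) x" for x
    using assms by (simp add: normal_density_def real_sqrt_mult real_sqrt_divide field_simps power2_eq_square)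
  interpret prob_space "density lborel (normal_density z (1 / k))"
    using assms by (intro prob_space_normal_density) auto
  have "(\<integral>\<^sup>+x. ennreal (normal_density z (1 / k) x) \<partial>lborel) = 1"
    using emeasure_space_1 by (simp add: emeasure_density)
  then show ?thesis
    unfolding eq using assms by (subst ennreal_mult) (simp_all del: times_divide_eq_left add: nn_integral_cmult)
qed

text \<open>
  With all weights \<open>e n\<close> equal to \<open>1\<close> this is the squared modulus of the characteristic function of the
  distribution of the sum of \<open>\<plusminus> l ^ n\<close>, over \<open>n \<in> A\<close>, with independent fair signs. A weight \<open>0\<close> drops the
  digit \<open>n\<close>, while the powers of \<open>l\<close> stay at their places.
\<close>
definition cosine_product :: "(nat \<Rightarrow> real) \<Rightarrow> nat set \<Rightarrow> real \<Rightarrow> real \<Rightarrow> real" where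
  "cosine_product e A l t = (\<Prod>n\<in>A. (cos (e n * l ^ n * t))\<^sup>2)"

lemma cosine_product_nonneg: "0 \<le> cosine_product e A l t"
  unfolding cosine_product_def by (intro prod_nonneg) simp

lemma cosine_product_le_1: "cosine_product e A l t \<le> 1"
  unfolding cosine_product_def by (intro prod_le_1) (auto simp: abs_square_le_1)

lemma cosine_product_measurable [measurable (raw)]:
  assumes [measurable]: "f \<in> borel_measurable M" "g \<in> borel_measurable M"
  shows "(\<lambda>x. cosine_product e A (f x) (g x)) \<in> borel_measurable M"
  unfolding cosine_product_def by measurable

lemma cosine_product_Suc:
  assumes "m < N"
  shows "cosine_product e {m..<N} l t = (cos (e m * l ^ m * t))\<^sup>2 * cosine_product e {Suc m..<N} l t"
  unfolding cosine_product_def using assms by (simp add: prod.atLeast_Suc_lessThan)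

text \<open>
  The parameter \<open>l\<close> is averaged over \<open>[a, b]\<close> and the frequency is \<open>R s\<close> with \<open>s\<close> standard normal. The last
  assumption is the hypothesis of \<open>transversality\<close> for the polynomial that is left when the difference of two
  digit sequences, which first differ at place \<open>k\<close>, is divided by \<open>l ^ k\<close>.
\<close>
locale parameter_average =
  fixes a b \<eta> :: real and e :: "nat \<Rightarrow> real"
  assumes a: "0 < a" and ab: "a \<le> b" and b: "b < 1" and \<eta>: "0 < \<eta>"
    and e: "\<And>n. e n \<in> {0, 1}"
    and transversal: "\<And>k M. e k = 1 \<Longrightarrow> (\<Sum>i = 1..<M. \<bar>real i - 4\<bar> * e (k + i) * b ^ i) \<le> 4 - \<eta>"
begin

abbreviation "I \<equiv> density lborel (indicator {a..b})"
abbreviation "\<gamma> \<equiv> std_normal_distribution"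
abbreviation "Q \<equiv> I \<Otimes>\<^sub>M \<gamma>"
abbreviation "D \<equiv> sqrt (2 * pi) / (2 * (a ^ 4 * \<eta>))"

lemma sets_I [measurable_cong]: "sets I = sets borel" by simp

lemma emeasure_I: "emeasure I UNIV = ennreal (b - a)"
  using ab by (simp add: emeasure_density)

interpretation N: prob_space \<gamma>
  by (rule prob_space_normal_density) simp

interpretation I: finite_measure I
  by (rule finite_measureI) (simp add: emeasure_I)

interpretation Q: finite_measure Q
  by (intro finite_measure_pair_measure I.finite_measure_axioms N.finite_measure_axioms)

interpretation Q: pair_sigma_finite I \<gamma> ..

lemma emeasure_Q: "emeasure Q UNIV = ennreal (b - a)"
  using N.emeasure_pair_measure_Times[of UNIV I UNIV] N.emeasure_space_1
  by (simp add: emeasure_I)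

lemma measure_Q: "measure Q (space Q) \<le> 1"
  using ab a b by (simp add: measure_def space_pair_measure emeasure_Q)

lemma integrable_Q:
  assumes [measurable]: "f \<in> borel_measurable (borel \<Otimes>\<^sub>M borel)" and "\<And>z. \<bar>f z :: real\<bar> \<le> 1"
  shows "integrable Q f"
proof (rule Q.integrable_const_bound[where B = 1])
  have "sets Q = sets (borel \<Otimes>\<^sub>M borel)" by (intro sets_pair_measure_cong) auto
  from measurable_cong_sets[OF this refl] assms(1) show "f \<in> borel_measurable Q" by (rule ssubst)
qed (use assms in auto)

text \<open>
  Integrating over \<open>s\<close> turns the cosine into \<open>exp (- (2 R q l)\<^sup>2 / 2)\<close>, where \<open>q l\<close> is \<open>l ^ k\<close> times a polynomial
  with constant coefficient \<open>1\<close>. By transversality \<open>\<bar>q l\<bar>\<close> is at least a multiple of \<open>a ^ k \<bar>l - z\<bar>\<close>, so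
  the integral over \<open>l\<close> is at most that of a Gaussian whose width is of order \<open>1 / (R a ^ k)\<close>. The constant \<open>D\<close> is
  the integral of this Gaussian for \<open>R = 1\<close> and \<open>k = 0\<close>.
\<close>
lemma oscillation_bound:
  assumes R: "0 < R" and k: "k < m" and dk: "d k = 1" and d: "\<And>n. \<bar>d n\<bar> \<le> e n"
  shows "(LINT z|Q. cos (2 * R * snd z * (\<Sum>n = k..<m. d n * fst z ^ n))) \<le> D / (R * a ^ k)"
proof -
  define q where "q x = (\<Sum>n = k..<m. d n * x ^ n)" for x
  have [measurable]: "q \<in> borel_measurable borel" unfolding q_def by measurable
  have ek: "e k = 1" using e[of k] d[of k] dk by auto
  have "\<exists>z. \<forall>x\<in>{a..b}. a ^ 4 * \<eta> * \<bar>x - z\<bar> \<le> \<bar>\<Sum>i<m - k. d (k + i) * x ^ i\<bar>"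
    using transversality[of a b \<eta> "\<lambda>i. d (k + i)" "m - k" "\<lambda>i. e (k + i)"]
      a b \<eta> dk d k transversal[OF ek, of "m - k"] by simp
  then obtain z where z: "\<And>x. x \<in> {a..b} \<Longrightarrow> a ^ 4 * \<eta> * \<bar>x - z\<bar> \<le> \<bar>\<Sum>i<m - k. d (k + i) * x ^ i\<bar>"
    by blast
  have q_shift: "q x = x ^ k * (\<Sum>i<m - k. d (k + i) * x ^ i)" for x
  proof -
    have "q x = (\<Sum>i = 0..<m - k. d (i + k) * x ^ (i + k))"
      unfolding q_def using sum.shift_bounds_nat_ivl[of "\<lambda>n. d n * x ^ n" 0 k "m - k"] k by simp
    then show ?thesis by (simp add: lessThan_atLeast0 sum_distrib_left power_add ac_simps)
  qed
  define \<kappa> where "\<kappa> = 2 * R * a ^ k * (a ^ 4 * \<eta>)"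
  have \<kappa>: "0 < \<kappa>" using a \<eta> R by (simp add: \<kappa>_def)
  have q_lower: "\<kappa> * \<bar>x - z\<bar> \<le> \<bar>2 * R * q x\<bar>" if x: "x \<in> {a..b}" for x
  proof -
    have "a ^ k * (a ^ 4 * \<eta> * \<bar>x - z\<bar>) \<le> x ^ k * \<bar>\<Sum>i<m - k. d (k + i) * x ^ i\<bar>"
      using z[OF x] x a \<eta> by (intro mult_mono power_mono) auto
    then have "2 * R * (a ^ k * (a ^ 4 * \<eta> * \<bar>x - z\<bar>)) \<le> 2 * R * (x ^ k * \<bar>\<Sum>i<m - k. d (k + i) * x ^ i\<bar>)"
      using R by (intro mult_left_mono) auto
    then show ?thesis
      using x a R by (simp add: q_shift \<kappa>_def abs_mult mult.assoc)
  qed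
  have int: "integrable Q (\<lambda>z. cos (2 * R * snd z * q (fst z)))"
    by (rule integrable_Q) auto
  have "(LINT z|Q. cos (2 * R * snd z * q (fst z)))
      = (LINT x|I. LINT s|\<gamma>. cos (2 * R * q x * s))"
    using Q.integral_fst'[OF int, symmetric] by (simp add: ac_simps)
  also have "\<dots> = (LINT x|I. exp (- ((2 * R * q x)\<^sup>2) / 2))"
    by (simp only: gauss_cos_integral)
  also have "\<dots> \<le> D / (R * a ^ k)"
  proof (rule integral_real_bounded)
    have "(\<integral>\<^sup>+x. ennreal (exp (- ((2 * R * q x)\<^sup>2) / 2)) \<partial>I)
        = (\<integral>\<^sup>+x. indicator {a..b} x * ennreal (exp (- ((2 * R * q x)\<^sup>2) / 2)) \<partial>lborel)"
      by (rule nn_integral_density) measurable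
    also have "\<dots> \<le> (\<integral>\<^sup>+x. ennreal (exp (- (\<kappa> * (x - z))\<^sup>2 / 2)) \<partial>lborel)"
    proof (rule nn_integral_mono)
      fix x :: real
      have "\<bar>\<kappa> * (x - z)\<bar> \<le> \<bar>2 * R * q x\<bar>" if "x \<in> {a..b}"
        using q_lower[OF that] \<kappa> by (simp add: abs_mult)
      then show "indicator {a..b} x * ennreal (exp (- ((2 * R * q x)\<^sup>2) / 2))
          \<le> ennreal (exp (- (\<kappa> * (x - z))\<^sup>2 / 2))"
        by (auto simp: abs_le_square_iff split: split_indicator intro!: ennreal_leI)
    qed
    also have "\<dots> = ennreal (sqrt (2 * pi) / \<kappa>)" by (rule gauss_translate_nn_integral[OF \<kappa>])
    also have "sqrt (2 * pi) / \<kappa> = D / (R * a ^ k)" by (simp add: \<kappa>_def ac_simps)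
    finally show "(\<integral>\<^sup>+x. ennreal (exp (- ((2 * R * q x)\<^sup>2) / 2)) \<partial>I) \<le> ennreal (D / (R * a ^ k))" .
  qed (use a \<eta> R in auto)
  finally show ?thesis by (simp add: q_def)
qed

text \<open>
  The identity \<open>cos A cos\<^sup>2 B = cos A / 2 + cos (A + 2 B) / 4 + cos (A - 2 B) / 4\<close> moves one factor of the product
  into the cosine, appending one more coefficient \<open>0\<close>, \<open>e m\<close> or \<open>- e m\<close> to the polynomial. A bound that
  is uniform in the coefficients survives these averages.
\<close>
lemma oscillation_product_bound:
  assumes R: "0 < R" and mN: "m \<le> N" and k: "k < m" and dk: "d k = 1" and d: "\<And>n. \<bar>d n\<bar> \<le> e n"
  shows "(LINT z|Q. cos (2 * R * snd z * (\<Sum>n = k..<m. d n * fst z ^ n))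
      * cosine_product e {m..<N} (fst z) (R * snd z)) \<le> D / (R * a ^ k)"
  using mN k dk d
proof (induction m arbitrary: d rule: inc_induct)
  case base
  then show ?case using oscillation_bound[OF R, of k N d] by (simp add: cosine_product_def)
next
  case (step m)
  let ?F = "\<lambda>d M z. cos (2 * R * snd z * (\<Sum>n = k..<M. d n * fst z ^ n))
      * cosine_product e {M..<N} (fst z) (R * snd z)"
  have bound: "\<bar>?F d M z\<bar> \<le> 1" for d M z
    using abs_cos_le_one[of "2 * R * snd z * (\<Sum>n = k..<M. d n * fst z ^ n)"]
      cosine_product_le_1[of e "{M..<N}" "fst z" "R * snd z"]
      cosine_product_nonneg[of e "{M..<N}" "fst z" "R * snd z"]
    by (simp add: abs_mult) (intro mult_le_one, auto)
  have int: "integrable Q (?F d M)" for d M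
    by (rule integrable_Q[OF _ bound]) measurable
  \<comment> \<open>The three possible values of the next coefficient.\<close>
  define d0 dp dm where "d0 = d(m := 0)" and "dp = d(m := e m)" and "dm = d(m := - e m)"
  have expand: "?F d m z = 1/2 * ?F d0 (Suc m) z + 1/4 * ?F dp (Suc m) z + 1/4 * ?F dm (Suc m) z" for z
  proof -
    have cong: "(\<Sum>n = k..<m. f n * fst z ^ n) = (\<Sum>n = k..<m. d n * fst z ^ n)" if "\<And>n. n < m \<Longrightarrow> f n = d n" for f
      using that by (intro sum.cong) auto
    define A where "A = 2 * R * snd z * (\<Sum>n = k..<m. d n * fst z ^ n)"
    define B where "B = e m * fst z ^ m * (R * snd z)"
    have sums: "2 * R * snd z * (\<Sum>n = k..<Suc m. d0 n * fst z ^ n) = A"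
      "2 * R * snd z * (\<Sum>n = k..<Suc m. dp n * fst z ^ n) = A + 2 * B"
      "2 * R * snd z * (\<Sum>n = k..<Suc m. dm n * fst z ^ n) = A - 2 * B"
      using step(4) cong[of d0] cong[of dp] cong[of dm]
      by (auto simp: A_def B_def d0_def dp_def dm_def algebra_simps)
    have "cos A * (cos B)\<^sup>2 = 1/2 * cos A + 1/4 * cos (A + 2 * B) + 1/4 * cos (A - 2 * B)"
    proof -
      have "(cos B)\<^sup>2 = 1/2 + 1/2 * cos (2 * B)" using cos_double_cos[of B] by linarith
      then show ?thesis by (simp add: cos_add cos_diff algebra_simps)
    qed
    then show ?thesis
      unfolding sums cosine_product_Suc[OF step(2)] A_def[symmetric] B_def[symmetric]
      by (simp only: mult.assoc[symmetric] distrib_right)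
  qed
  have lin: "(LINT z|Q. 1/2 * f z + 1/4 * g z + 1/4 * h z)
      = 1/2 * (LINT z|Q. f z) + 1/4 * (LINT z|Q. g z) + 1/4 * (LINT z|Q. h z)"
    if "integrable Q f" "integrable Q g" "integrable Q h" for f g h :: "real \<times> real \<Rightarrow> real"
    using that by simp
  have em: "0 \<le> e m" using e[of m] by auto
  have le: "(LINT z|Q. ?F f (Suc m) z) \<le> D / (R * a ^ k)" if "f \<in> {d0, dp, dm}" for f
    using that step(4-6) em
    by (intro step.IH) (auto simp: d0_def dp_def dm_def less_Suc_eq)
  have "(LINT z|Q. ?F d m z) = 1/2 * (LINT z|Q. ?F d0 (Suc m) z) + 1/4 * (LINT z|Q. ?F dp (Suc m) z)
      + 1/4 * (LINT z|Q. ?F dm (Suc m) z)"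
    unfolding expand by (rule lin[OF int int int])
  moreover have "(LINT z|Q. ?F d0 (Suc m) z) \<le> D / (R * a ^ k)"
    "(LINT z|Q. ?F dp (Suc m) z) \<le> D / (R * a ^ k)"
    "(LINT z|Q. ?F dm (Suc m) z) \<le> D / (R * a ^ k)"
    by (rule le; simp)+
  ultimately show ?case by linarith
qed

text \<open>
  Here \<open>cos\<^sup>2 B = (1 + cos (2 B)) / 2\<close> is applied to the first remaining factor: the constant part stands for pairs of
  digit sequences that agree at this place, the cosine for pairs that differ there. The pairs that agree
  before place \<open>k\<close> have weight \<open>\<Prod>n<k. 1 - e n / 2\<close>, so that the pairs that first differ at \<open>k\<close> contribute at most a multiple of
  \<open>(\<rho> / a) ^ k / R\<close>; the pairs that agree up to \<open>N\<close> contribute at most \<open>\<rho> ^ N\<close>.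
\<close>
lemma product_average:
  assumes R: "0 < R" and \<rho>: "0 < \<rho>" "\<rho> < a"
    and p: "\<And>k. (\<Prod>n<k. 1 - e n / 2) \<le> \<rho> ^ k"
  shows "(LINT z|Q. cosine_product e {0..<N} (fst z) (R * snd z)) \<le> \<rho> ^ N + D / R / (1 - \<rho> / a)"
proof -
  define V where "V k = (LINT z|Q. cosine_product e {k..<N} (fst z) (R * snd z))" for k
  define p where "p k = (\<Prod>n<k. 1 - e n / 2)" for k
  have p_nonneg: "0 \<le> p k" for k
    unfolding p_def
  proof (rule prod_nonneg)
    show "0 \<le> 1 - e n / 2" for n using e[of n] by auto
  qed
  have e_nonneg: "0 \<le> e n" for n using e[of n] by auto
  have int: "integrable Q (\<lambda>z. cosine_product e {k..<N} (fst z) (R * snd z))" for k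
    by (rule integrable_Q) (auto simp: cosine_product_nonneg cosine_product_le_1)
  have V_step: "p k * V k \<le> p (Suc k) * V (Suc k) + p k * (D / (R * a ^ k))" if k: "k < N" for k
  proof (cases "e k = 1")
    case False
    then have "e k = 0" using e[of k] by auto
    then have "V k = V (Suc k)" "p (Suc k) = p k"
      unfolding V_def p_def by (simp_all add: cosine_product_Suc[OF k])
    then show ?thesis using p_nonneg[of k] a \<eta> R by simp
  next
    case True
    let ?c = "\<lambda>z. cos (2 * R * snd z * (\<Sum>n = k..<Suc k. (if n = k then 1 else 0) * fst z ^ n))
      * cosine_product e {Suc k..<N} (fst z) (R * snd z)"
    have "\<bar>?c z\<bar> \<le> 1" for z
      using cosine_product_le_1[of e "{Suc k..<N}" "fst z" "R * snd z"]
        cosine_product_nonneg[of e "{Suc k..<N}" "fst z" "R * snd z"]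
      by (simp add: abs_mult) (intro mult_le_one, auto)
    then have intc: "integrable Q ?c" by (intro integrable_Q) measurable
    have "(cos B)\<^sup>2 = 1/2 + 1/2 * cos (2 * B)" for B :: real
      using cos_double_cos[of B] by linarith
    then have "cosine_product e {k..<N} (fst z) (R * snd z)
        = 1/2 * cosine_product e {Suc k..<N} (fst z) (R * snd z) + 1/2 * ?c z" for z
      using True by (simp add: cosine_product_Suc[OF k] algebra_simps)
    then have "V k = 1/2 * V (Suc k) + 1/2 * (LINT z|Q. ?c z)"
      unfolding V_def using int[of "Suc k"] intc by simp
    also have "(LINT z|Q. ?c z) \<le> D / (R * a ^ k)"
      using k e_nonneg True by (intro oscillation_product_bound[OF R]) (auto split: if_splits)
    finally have "V k \<le> 1/2 * V (Suc k) + 1/2 * (D / (R * a ^ k))" by simp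
    moreover have "0 \<le> D / (R * a ^ k)" using a \<eta> R by simp
    ultimately have "V k \<le> 1/2 * V (Suc k) + D / (R * a ^ k)" by linarith
    then have "p k * V k \<le> p k * (1/2 * V (Suc k) + D / (R * a ^ k))"
      using p_nonneg by (intro mult_left_mono)
    moreover have "p (Suc k) = p k * (1/2)" using True by (simp add: p_def)
    ultimately show ?thesis by (simp only: distrib_left mult.assoc)
  qed
  have "p 0 * V 0 \<le> p N * V N + (\<Sum>k<N. p k * (D / (R * a ^ k)))"
  proof -
    have "p 0 * V 0 \<le> p j * V j + (\<Sum>k<j. p k * (D / (R * a ^ k)))" if "j \<le> N" for j
      using that
    proof (induction j)
      case (Suc j)
      then show ?case using V_step[of j] by auto
    qed simp
    then show ?thesis by blast
  qed
  also have "p N * V N \<le> \<rho> ^ N"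
  proof -
    have "V N \<le> 1" using measure_Q by (simp add: V_def cosine_product_def)
    then have "p N * V N \<le> p N" using p_nonneg[of N] by (metis mult.commute mult_left_le)
    also have "\<dots> \<le> \<rho> ^ N" using p by (simp add: p_def)
    finally show ?thesis .
  qed
  also have "(\<Sum>k<N. p k * (D / (R * a ^ k))) \<le> (\<Sum>k<N. D / R * (\<rho> / a) ^ k)"
  proof (rule sum_mono)
    fix k
    have "p k * (D / (R * a ^ k)) \<le> \<rho> ^ k * (D / (R * a ^ k))"
      using p[of k] a \<eta> R by (intro mult_right_mono) (auto simp: p_def)
    then show "p k * (D / (R * a ^ k)) \<le> D / R * (\<rho> / a) ^ k"
      by (simp add: power_divide field_simps)
  qed
  also have "\<dots> = D / R * (\<Sum>k<N. (\<rho> / a) ^ k)" by (simp add: sum_distrib_left)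
  also have "D / R * (\<Sum>k<N. (\<rho> / a) ^ k) \<le> D / R * (1 / (1 - \<rho> / a))"
  proof (rule mult_left_mono)
    have r: "0 \<le> \<rho> / a" "\<rho> / a < 1" using \<rho> a by auto
    then show "(\<Sum>k<N. (\<rho> / a) ^ k) \<le> 1 / (1 - \<rho> / a)"
      using sum_le_suminf[of "\<lambda>k. (\<rho> / a) ^ k" "{..<N}"] by (simp add: suminf_geometric summable_geometric)
  qed (use a \<eta> R in auto)
  finally show ?thesis by (simp add: V_def p_def)
qed

end

text \<open>
  The products decrease in \<open>N\<close>, so that the infimum is their limit. With values in \<open>ennreal\<close> it is
  jointly measurable in \<open>l\<close> and \<open>t\<close> and can be integrated without further conditions.
\<close>
definition cosine_limit :: "(nat \<Rightarrow> real) \<Rightarrow> real \<Rightarrow> real \<Rightarrow> ennreal" where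
  "cosine_limit e l t = (INF N. ennreal (cosine_product e {0..<N} l t))"

lemma cosine_limit_measurable [measurable (raw)]:
  assumes [measurable]: "f \<in> borel_measurable M" "g \<in> borel_measurable M"
  shows "(\<lambda>x. cosine_limit e (f x) (g x)) \<in> borel_measurable M"
  unfolding cosine_limit_def by measurable

text \<open>
  The normal density is at least \<open>exp (- 1 / 2) / sqrt (2 * pi)\<close> on \<open>[-1, 1]\<close>. The factor \<open>1 / R\<close> comes from rescaling the
  frequency and matches the decay in \<open>product_average\<close>.
\<close>
lemma gauss_average_ge:
  fixes f :: "real \<Rightarrow> ennreal"
  assumes R: "0 < R" and [measurable]: "f \<in> borel_measurable borel"
  shows "ennreal (exp (- 1 / 2) / sqrt (2 * pi) / R) * (\<integral>\<^sup>+t. f t * indicator {-R..R} t \<partial>lborel)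
    \<le> (\<integral>\<^sup>+s. f (R * s) \<partial>std_normal_distribution)"
proof -
  have "(\<integral>\<^sup>+t. f t * indicator {-R..R} t \<partial>lborel)
      = ennreal R * (\<integral>\<^sup>+s. f (R * s) * indicator {-R..R} (R * s) \<partial>lborel)"
    using nn_integral_real_affine[of "\<lambda>t. f t * indicator {-R..R} t" R 0] R by simp
  also have "ennreal (exp (- 1 / 2) / sqrt (2 * pi) / R) * \<dots>
      = ennreal (exp (- 1 / 2) / sqrt (2 * pi)) * (\<integral>\<^sup>+s. f (R * s) * indicator {-R..R} (R * s) \<partial>lborel)"
    using R by (simp add: mult.assoc[symmetric] ennreal_mult[symmetric])
  also have "\<dots> = (\<integral>\<^sup>+s. ennreal (exp (- 1 / 2) / sqrt (2 * pi)) * (f (R * s) * indicator {-R..R} (R * s)) \<partial>lborel)"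
    by (rule nn_integral_cmult[symmetric]) measurable
  also have "\<dots> \<le> (\<integral>\<^sup>+s. ennreal (std_normal_density s) * f (R * s) \<partial>lborel)"
  proof (rule nn_integral_mono)
    fix s :: real
    have "exp (- 1 / 2) / sqrt (2 * pi) \<le> std_normal_density s" if "R * s \<in> {-R..R}"
    proof -
      have "R * s \<le> R * 1" "R * (- 1) \<le> R * s" using that by auto
      then have "s \<le> 1" "- 1 \<le> s" using R by (simp_all only: mult_le_cancel_left_pos)
      then have "\<bar>s\<bar> \<le> 1" by simp
      then have "s\<^sup>2 \<le> 1" by (simp add: abs_square_le_1)
      then show ?thesis by (simp add: std_normal_density_def divide_right_mono)
    qed
    then show "ennreal (exp (- 1 / 2) / sqrt (2 * pi)) * (f (R * s) * indicator {-R..R} (R * s))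
        \<le> ennreal (std_normal_density s) * f (R * s)"
      by (auto split: split_indicator intro!: mult_right_mono ennreal_leI)
  qed
  also have "\<dots> = (\<integral>\<^sup>+s. f (R * s) \<partial>std_normal_distribution)"
    by (rule nn_integral_density[symmetric]) measurable
  finally show ?thesis .
qed

context parameter_average
begin

text \<open>
  The average over \<open>l\<close> of the integral over \<open>t \<in> [-R, R]\<close> is bounded independently of \<open>R\<close>. By monotone
  convergence the average of the full integral is finite, hence almost every one of these integrals is.
\<close>
lemma AE_cosine_limit_integrable:
  assumes \<rho>: "0 < \<rho>" "\<rho> < a" and p: "\<And>k. (\<Prod>n<k. 1 - e n / 2) \<le> \<rho> ^ k"
  shows "AE l in lborel. l \<in> {a..b} \<longrightarrow> (\<integral>\<^sup>+t. cosine_limit e l t \<partial>lborel) < \<infinity>"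
proof -
  interpret N: prob_space \<gamma> by (rule prob_space_normal_density) simp
  interpret I: finite_measure I by (rule finite_measureI) (simp add: emeasure_I)
  define C where "C = D / (1 - \<rho> / a)"
  have C: "0 \<le> C" using \<rho> a \<eta> by (simp add: C_def)
  define c where "c = exp (- 1 / 2) / sqrt (2 * pi)"
  have c: "0 < c" by (simp add: c_def)
  have Q_le: "(\<integral>\<^sup>+z. cosine_limit e (fst z) (R * snd z) \<partial>Q) \<le> ennreal (C / R)" if R: "0 < R" for R
  proof -
    have "(\<integral>\<^sup>+z. cosine_limit e (fst z) (R * snd z) \<partial>Q) \<le> ennreal (\<rho> ^ N + C / R)" for N
    proof -
      have "(\<integral>\<^sup>+z. cosine_limit e (fst z) (R * snd z) \<partial>Q)
          \<le> (\<integral>\<^sup>+z. ennreal (cosine_product e {0..<N} (fst z) (R * snd z)) \<partial>Q)"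
        unfolding cosine_limit_def by (intro nn_integral_mono INF_lower) simp
      also have "\<dots> = ennreal (LINT z|Q. cosine_product e {0..<N} (fst z) (R * snd z))"
        by (intro nn_integral_eq_integral integrable_Q) (auto simp: cosine_product_nonneg cosine_product_le_1)
      also have "\<dots> \<le> ennreal (\<rho> ^ N + C / R)"
        using product_average[OF R \<rho> p, of N] by (intro ennreal_leI) (simp add: C_def ac_simps)
      finally show ?thesis .
    qed
    moreover have "(\<lambda>N. ennreal (\<rho> ^ N + C / R)) \<longlonglongrightarrow> ennreal (0 + C / R)"
      using \<rho> ab b by (intro tendsto_ennrealI tendsto_intros LIMSEQ_power_zero) auto
    ultimately show ?thesis by (auto intro: LIMSEQ_le_const)
  qed
  have le: "(\<integral>\<^sup>+l. (\<integral>\<^sup>+t. cosine_limit e l t * indicator {-R..R} t \<partial>lborel) \<partial>I) \<le> ennreal (C / c)" if R: "0 < R" for R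
  proof -
    have "ennreal (c / R) * (\<integral>\<^sup>+l. (\<integral>\<^sup>+t. cosine_limit e l t * indicator {-R..R} t \<partial>lborel) \<partial>I)
        = (\<integral>\<^sup>+l. ennreal (c / R) * (\<integral>\<^sup>+t. cosine_limit e l t * indicator {-R..R} t \<partial>lborel) \<partial>I)"
      by (rule nn_integral_cmult[symmetric]) measurable
    also have "\<dots> \<le> (\<integral>\<^sup>+l. (\<integral>\<^sup>+s. cosine_limit e l (R * s) \<partial>\<gamma>) \<partial>I)"
      unfolding c_def by (intro nn_integral_mono gauss_average_ge R) measurable
    also have "\<dots> = (\<integral>\<^sup>+z. cosine_limit e (fst z) (R * snd z) \<partial>Q)"
      by (subst N.nn_integral_fst[symmetric]) auto
    also note Q_le[OF R]
    finally have "ennreal (c / R) * (\<integral>\<^sup>+l. (\<integral>\<^sup>+t. cosine_limit e l t * indicator {-R..R} t \<partial>lborel) \<partial>I)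
      \<le> ennreal (C / R)" .
    then have "ennreal (R / c) * (ennreal (c / R) * (\<integral>\<^sup>+l. (\<integral>\<^sup>+t. cosine_limit e l t * indicator {-R..R} t \<partial>lborel) \<partial>I))
      \<le> ennreal (R / c) * ennreal (C / R)" by (intro mult_left_mono) auto
    then show ?thesis
      using R c C by (simp add: mult.assoc[symmetric] ennreal_mult[symmetric])
  qed
  define B where "B n = {-real (Suc n)..real (Suc n)}" for n
  have [measurable]: "B n \<in> sets borel" for n by (simp add: B_def)
  have B_mono: "m \<le> n \<Longrightarrow> t \<in> B m \<Longrightarrow> t \<in> B n" for m n t by (auto simp: B_def)
  have "(\<integral>\<^sup>+l. (\<integral>\<^sup>+t. cosine_limit e l t \<partial>lborel) \<partial>I)
      = (\<integral>\<^sup>+l. (SUP n. (\<integral>\<^sup>+t. cosine_limit e l t * indicator (B n) t \<partial>lborel)) \<partial>I)"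
  proof (intro nn_integral_cong)
    fix l
    have "(SUP n. indicator (B n) t :: ennreal) = 1" for t
    proof (rule antisym)
      obtain n where "\<bar>t\<bar> \<le> real n" using real_arch_simple by blast
      then have "indicator (B n) t = (1 :: ennreal)" by (auto simp: B_def split: split_indicator)
      then show "1 \<le> (SUP n. indicator (B n) t :: ennreal)"
        by (intro SUP_upper2[of n]) auto
    qed (intro SUP_least, simp split: split_indicator)
    then have "(\<integral>\<^sup>+t. cosine_limit e l t \<partial>lborel)
        = (\<integral>\<^sup>+t. (SUP n. cosine_limit e l t * indicator (B n) t) \<partial>lborel)"
      by (simp add: SUP_mult_left_ennreal[symmetric])
    also have "\<dots> = (SUP n. (\<integral>\<^sup>+t. cosine_limit e l t * indicator (B n) t \<partial>lborel))"
      by (intro nn_integral_monotone_convergence_SUP)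
        (auto simp: incseq_def le_fun_def dest: B_mono split: split_indicator)
    finally show "(\<integral>\<^sup>+t. cosine_limit e l t \<partial>lborel)
        = (SUP n. (\<integral>\<^sup>+t. cosine_limit e l t * indicator (B n) t \<partial>lborel))" .
  qed
  also have "\<dots> = (SUP n. (\<integral>\<^sup>+l. (\<integral>\<^sup>+t. cosine_limit e l t * indicator (B n) t \<partial>lborel) \<partial>I))"
    by (intro nn_integral_monotone_convergence_SUP)
      (auto simp: incseq_def le_fun_def dest: B_mono split: split_indicator intro!: nn_integral_mono)
  also have "\<dots> \<le> ennreal (C / c)" by (intro SUP_least) (simp only: B_def le of_nat_0_less_iff zero_less_Suc)
  also have "\<dots> < \<infinity>" by simp
  finally have "AE l in I. (\<integral>\<^sup>+t. cosine_limit e l t \<partial>lborel) \<noteq> \<infinity>"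
    by (intro nn_integral_PInf_AE) (auto simp: less_top)
  then have "AE l in lborel. indicator {a..b} l > (0 :: ennreal) \<longrightarrow> (\<integral>\<^sup>+t. cosine_limit e l t \<partial>lborel) \<noteq> \<infinity>"
    by (subst (asm) AE_density) auto
  then show ?thesis by eventually_elim (auto simp: less_top split: split_indicator_asm)
qed

end

section \<open>Integrable cosine products for almost every parameter\<close>

text \<open>
  The value \<open>\<phi> j\<close> is an upper bound for the tail of the series from the \<open>j\<close>-th block of length \<open>p\<close> on.
\<close>
lemma sum_le_potential:
  fixes f \<phi> :: "nat \<Rightarrow> real"
  assumes f: "\<And>i. 0 \<le> f i" and \<phi>: "\<And>j. start \<le> j \<Longrightarrow> 0 \<le> \<phi> j"
    and init: "(\<Sum>i<p * start. f i) + \<phi> start \<le> C"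
    and step: "\<And>j. start \<le> j \<Longrightarrow> \<phi> (Suc j) + (\<Sum>i = p * j..<p * Suc j. f i) \<le> \<phi> j"
    and p: "0 < p"
  shows "(\<Sum>i<M. f i) \<le> C"
proof -
  have *: "(\<Sum>i<p * j. f i) + \<phi> j \<le> C" if "start \<le> j" for j
    using that
  proof (induction j rule: dec_induct)
    case (step j)
    have "(\<Sum>i<p * Suc j. f i) = (\<Sum>i<p * j. f i) + (\<Sum>i = p * j..<p * Suc j. f i)"
      unfolding lessThan_atLeast0 by (rule sum.atLeastLessThan_concat[symmetric]) auto
    then show ?case using assms(4)[of j] step by linarith
  qed (rule init)
  have "M \<le> p * (M + start)" using p by (cases p) auto
  then have "(\<Sum>i<M. f i) \<le> (\<Sum>i<p * (M + start). f i)"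
    by (intro sum_mono2) (auto simp: f)
  also have "\<dots> \<le> C" using *[of "M + start"] \<phi>[of "M + start"] by simp
  finally show ?thesis .
qed

lemma sum_from_1_eq:
  fixes f :: "nat \<Rightarrow> real"
  shows "(\<Sum>i = 1..<M. f i) = (\<Sum>i<M. if i = 0 then 0 else f i)"
  by (intro sum.mono_neutral_cong_left) auto

text \<open>
  The tail from \<open>j\<close> on is an arithmetic-geometric series, so its sum has the form \<open>(\<alpha> j + \<beta>) (16/25) ^ j\<close>; the
  potential rounds \<open>\<alpha>\<close> and \<open>\<beta>\<close> up to simple fractions.
\<close>
lemma all_digits_sum:
  "(\<Sum>i = 1..<M. \<bar>real i - 4\<bar> * 1 * (16/25) ^ i) \<le> 4 - 1/10"
  unfolding sum_from_1_eq
proof (rule sum_le_potential[where p = 1 and start = 5 and \<phi> = "\<lambda>j. (14/5 * real j - 61/10) * (16/25) ^ j"])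
  fix j :: nat assume j: "5 \<le> j"
  have "(14/5 * real (Suc j) - 61/10) * (16/25) + (real j - 4) \<le> 14/5 * real j - 61/10"
    using j by (simp add: field_simps)
  then have "((14/5 * real (Suc j) - 61/10) * (16/25) + (real j - 4)) * (16/25) ^ j
      \<le> (14/5 * real j - 61/10) * (16/25) ^ j"
    by (rule mult_right_mono) simp
  then show "(14/5 * real (Suc j) - 61/10) * (16/25) ^ Suc j
      + (\<Sum>i = 1 * j..<1 * Suc j. if i = 0 then 0 else \<bar>real i - 4\<bar> * 1 * (16/25) ^ i)
      \<le> (14/5 * real j - 61/10) * (16/25) ^ j"
    using j by (simp add: algebra_simps)
qed (auto simp: lessThan_nat_numeral lessThan_Suc eval_nat_numeral)

text \<open>
  Dropping every third digit makes the polynomials sparser, and transversality then persists beyond \<open>16/25\<close>. The price is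
  the weight \<open>4 ^ (- k / 3)\<close> in place of \<open>2 ^ (- k)\<close> for agreement up to place \<open>k\<close>, which is affordable for
  \<open>l > 4 powr (- 1 / 3)\<close>, in particular for \<open>l \<ge> 16/25\<close>.
\<close>
definition two_of_three :: "nat \<Rightarrow> real" where
  "two_of_three n = (if n mod 3 = 2 then 0 else 1)"

lemma two_of_three_add: "two_of_three (k + i) = two_of_three (k mod 3 + i mod 3)"
  unfolding two_of_three_def by (simp add: mod_add_eq)

text \<open>
  The digit \<open>k\<close>, being retained, has residue \<open>0\<close> or \<open>1\<close> modulo \<open>3\<close>, and then the dropped exponents \<open>i\<close> are those
  of residue \<open>2\<close> or \<open>1\<close>, respectively. In both cases the tail is an arithmetic-geometric series in blocks of three,
  and the potential again rounds its closed form up.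
\<close>
lemma two_of_three_sum:
  assumes k: "two_of_three k = 1"
  shows "(\<Sum>i = 1..<M. \<bar>real i - 4\<bar> * two_of_three (k + i) * (442/625) ^ i) \<le> 4 - 1/10"
proof -
  have block: "{3 * j..<3 * Suc j} = {3 * j, 3 * j + 1, 3 * j + 2}" for j :: nat by auto
  define x :: real where "x = 442/625"
  have x3: "x ^ (3 * j + c) = x ^ c * (x ^ 3) ^ j" for j c
    by (simp add: power_add power_mult)
  have "k mod 3 = 0 \<or> k mod 3 = 1"
    using k by (auto simp: two_of_three_def split: if_splits)
  then show ?thesis
  proof
    assume k0: "k mod 3 = 0"
    have weight: "two_of_three (k + (3 * j + c)) = (if c mod 3 = 2 then 0 else 1)" for j c
      by (subst two_of_three_add) (simp add: k0 two_of_three_def)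
    show ?thesis unfolding sum_from_1_eq x_def[symmetric]
    proof (rule sum_le_potential[where p = 3 and start = 2 and \<phi> = "\<lambda>j. (793/100 * real j - 513/100) * (x ^ 3) ^ j"])
      fix j :: nat assume j: "2 \<le> j"
      have "(793/100 * real (Suc j) - 513/100) * x ^ 3 + ((3 * real j - 4) + (3 * real j - 3) * x)
          \<le> 793/100 * real j - 513/100"
        using j by (simp add: x_def power3_eq_cube field_simps)
      then have "((793/100 * real (Suc j) - 513/100) * x ^ 3 + ((3 * real j - 4) + (3 * real j - 3) * x)) * (x ^ 3) ^ j
          \<le> (793/100 * real j - 513/100) * (x ^ 3) ^ j"
        by (rule mult_right_mono) (simp add: x_def)
      moreover have "(\<Sum>i = 3 * j..<3 * Suc j. if i = 0 then 0 else \<bar>real i - 4\<bar> * two_of_three (k + i) * x ^ i)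
          = ((3 * real j - 4) + (3 * real j - 3) * x) * (x ^ 3) ^ j"
        using j weight[of j 0] weight[of j 1] weight[of j 2] x3[of j 0] x3[of j 1] x3[of j 2]
        unfolding block by (simp add: algebra_simps)
      ultimately show "(793/100 * real (Suc j) - 513/100) * (x ^ 3) ^ Suc j
          + (\<Sum>i = 3 * j..<3 * Suc j. if i = 0 then 0 else \<bar>real i - 4\<bar> * two_of_three (k + i) * x ^ i)
          \<le> (793/100 * real j - 513/100) * (x ^ 3) ^ j"
        by (simp only: distrib_right power_Suc mult.assoc)
    next
      have "{..<3 * 2} = {0, 1, 2, 3, 4, 5 :: nat}" by auto
      then show "(\<Sum>i<3 * 2. if i = 0 then 0 else \<bar>real i - 4\<bar> * two_of_three (k + i) * x ^ i)
          + (793/100 * real 2 - 513/100) * (x ^ 3) ^ 2 \<le> 4 - 1/10"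
        using weight[of 0 1] weight[of 0 2] weight[of 1 0] weight[of 1 1] weight[of 1 2]
        by (simp add: x_def power_divide)
    qed (auto simp: two_of_three_def x_def)
  next
    assume k1: "k mod 3 = 1"
    have weight: "two_of_three (k + (3 * j + c)) = (if c mod 3 = 1 then 0 else 1)" for j c
    proof -
      have "(Suc (c mod 3) mod 3 = 2) = (c mod 3 = 1)" by presburger
      then show ?thesis by (subst two_of_three_add) (simp add: k1 two_of_three_def)
    qed
    show ?thesis unfolding sum_from_1_eq x_def[symmetric]
    proof (rule sum_le_potential[where p = 3 and start = 2 and \<phi> = "\<lambda>j. (7 * real j - 39/10) * (x ^ 3) ^ j"])
      fix j :: nat assume j: "2 \<le> j"
      have "(7 * real (Suc j) - 39/10) * x ^ 3 + ((3 * real j - 4) + (3 * real j - 2) * x ^ 2)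
          \<le> 7 * real j - 39/10"
        using j by (simp add: x_def power3_eq_cube power2_eq_square field_simps)
      then have "((7 * real (Suc j) - 39/10) * x ^ 3 + ((3 * real j - 4) + (3 * real j - 2) * x ^ 2)) * (x ^ 3) ^ j
          \<le> (7 * real j - 39/10) * (x ^ 3) ^ j"
        by (rule mult_right_mono) (simp add: x_def)
      moreover have "(\<Sum>i = 3 * j..<3 * Suc j. if i = 0 then 0 else \<bar>real i - 4\<bar> * two_of_three (k + i) * x ^ i)
          = ((3 * real j - 4) + (3 * real j - 2) * x ^ 2) * (x ^ 3) ^ j"
        using j weight[of j 0] weight[of j 1] weight[of j 2] x3[of j 0] x3[of j 1] x3[of j 2]
        unfolding block by (simp add: algebra_simps power2_eq_square)
      ultimately show "(7 * real (Suc j) - 39/10) * (x ^ 3) ^ Suc j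
          + (\<Sum>i = 3 * j..<3 * Suc j. if i = 0 then 0 else \<bar>real i - 4\<bar> * two_of_three (k + i) * x ^ i)
          \<le> (7 * real j - 39/10) * (x ^ 3) ^ j"
        by (simp only: distrib_right power_Suc mult.assoc)
    next
      have "{..<3 * 2} = {0, 1, 2, 3, 4, 5 :: nat}" by auto
      then show "(\<Sum>i<3 * 2. if i = 0 then 0 else \<bar>real i - 4\<bar> * two_of_three (k + i) * x ^ i)
          + (7 * real 2 - 39/10) * (x ^ 3) ^ 2 \<le> 4 - 1/10"
        using weight[of 0 1] weight[of 0 2] weight[of 1 0] weight[of 1 1] weight[of 1 2]
        by (simp add: x_def power_divide)
    qed (auto simp: two_of_three_def x_def)
  qed
qed

text \<open>
  Three consecutive factors multiply to \<open>1/4\<close>, and \<open>(63/100) ^ 3\<close> is just above \<open>1/4\<close>.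
\<close>
lemma two_of_three_prod: "(\<Prod>n<k. 1 - two_of_three n / 2) \<le> (63/100) ^ k"
proof (induction k rule: less_induct)
  case (less k)
  let ?p = "\<lambda>k. \<Prod>n<k. 1 - two_of_three n / 2"
  consider "k = 0" | "k = 1" | "k = 2" | m where "k = m + 3"
    by (metis One_nat_def add.commute less_2_cases_iff less_Suc_eq_0_disj not_less_eq le_Suc_ex not_le numeral_2_eq_2 numeral_3_eq_3)
  then show ?case
  proof cases
    case (4 m)
    have "?p k = ?p m * ((1 - two_of_three m / 2) * (1 - two_of_three (m + 1) / 2) * (1 - two_of_three (m + 2) / 2))"
      by (simp add: 4 numeral_3_eq_3)
    also have "(1 - two_of_three m / 2) * (1 - two_of_three (m + 1) / 2) * (1 - two_of_three (m + 2) / 2) = 1/4"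
    proof -
      have "m mod 3 = 0 \<and> (m + 1) mod 3 = 1 \<and> (m + 2) mod 3 = 2 \<or> m mod 3 = 1 \<and> (m + 1) mod 3 = 2 \<and> (m + 2) mod 3 = 0
        \<or> m mod 3 = 2 \<and> (m + 1) mod 3 = 0 \<and> (m + 2) mod 3 = 1" by presburger
      then show ?thesis by (auto simp: two_of_three_def)
    qed
    also have "?p m * (1/4) \<le> (63/100) ^ m * (63/100) ^ 3"
      using less.IH[of m] 4 by (intro mult_mono) (auto simp: power3_eq_cube)
    finally show ?thesis by (simp only: 4 power_add)
  qed (auto simp: two_of_three_def numeral_2_eq_2)
qed

abbreviation char_energy :: "real \<Rightarrow> ennreal" where
  "char_energy l \<equiv> (\<integral>\<^sup>+t. cosine_limit (\<lambda>_. 1) l t \<partial>lborel)"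

lemma cosine_limit_all_digits_le:
  assumes e: "\<And>n. e n \<in> {0, 1}"
  shows "cosine_limit (\<lambda>_. 1) l t \<le> cosine_limit e l t"
  unfolding cosine_limit_def
proof (rule INF_mono)
  fix N
  have "(cos (1 * l ^ n * t))\<^sup>2 \<le> (cos (e n * l ^ n * t))\<^sup>2" for n
    using e[of n] by (auto simp: abs_square_le_1)
  then have "cosine_product (\<lambda>_. 1) {0..<N} l t \<le> cosine_product e {0..<N} l t"
    unfolding cosine_product_def by (intro prod_mono) auto
  then show "\<exists>M\<in>UNIV. ennreal (cosine_product (\<lambda>_. 1) {0..<M} l t) \<le> ennreal (cosine_product e {0..<N} l t)"
    by (intro bexI[of _ N] ennreal_leI) auto
qed

text \<open>
  The factors with even index in the product for \<open>l\<close> form the product for \<open>l\<^sup>2\<close>; the others are at most \<open>1\<close>.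
\<close>
lemma char_energy_square_le: "char_energy l \<le> char_energy (l\<^sup>2)"
proof (rule nn_integral_mono)
  fix t
  have "cosine_product (\<lambda>_. 1) {0..<2 * N} l t \<le> cosine_product (\<lambda>_. 1) {0..<N} (l\<^sup>2) t" for N
  proof (induction N)
    case (Suc N)
    have "cosine_product (\<lambda>_. 1) {0..<2 * Suc N} l t
        = cosine_product (\<lambda>_. 1) {0..<2 * N} l t * (cos (l ^ (2 * N) * t))\<^sup>2 * (cos (l ^ Suc (2 * N) * t))\<^sup>2"
      by (simp add: cosine_product_def)
    also have "\<dots> \<le> cosine_product (\<lambda>_. 1) {0..<2 * N} l t * (cos (l ^ (2 * N) * t))\<^sup>2"
      by (rule mult_left_le) (auto simp: abs_square_le_1 cosine_product_nonneg)
    also have "\<dots> \<le> cosine_product (\<lambda>_. 1) {0..<N} (l\<^sup>2) t * (cos (l ^ (2 * N) * t))\<^sup>2"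
      by (rule mult_right_mono[OF Suc.IH]) simp
    also have "\<dots> = cosine_product (\<lambda>_. 1) {0..<Suc N} (l\<^sup>2) t"
      by (simp add: cosine_product_def power_mult)
    finally show ?case .
  qed (simp add: cosine_product_def)
  then show "cosine_limit (\<lambda>_. 1) l t \<le> cosine_limit (\<lambda>_. 1) (l\<^sup>2) t"
    unfolding cosine_limit_def by (intro INF_mono) (blast intro: ennreal_leI)
qed

lemma char_energy_iterate_le: "char_energy l \<le> char_energy (l ^ (2 ^ j))"
proof (induction j)
  case (Suc j)
  note Suc
  also have "char_energy (l ^ (2 ^ j)) \<le> char_energy ((l ^ (2 ^ j))\<^sup>2)" by (rule char_energy_square_le)
  finally show ?case by (simp add: power_mult[symmetric] mult.commute)
qed simp

text \<open>
  Below \<open>16/25\<close> all digits are used, on intervals that stay away from \<open>1/2\<close> because \<open>product_average\<close> needs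
  \<open>\<rho> = 1/2\<close> to be strictly less than the left end. Above \<open>16/25\<close> the digits of \<open>two_of_three\<close> are used.
\<close>
lemma AE_char_energy_base:
  "AE l in lborel. l \<in> {1/2<..442/625} \<longrightarrow> char_energy l < \<infinity>"
proof -
  have "AE l in lborel. l \<in> {1/2 + 1 / real (Suc n + 10)..16/25} \<longrightarrow> char_energy l < \<infinity>" for n
  proof -
    interpret parameter_average "1/2 + 1 / real (Suc n + 10)" "16/25" "1/10" "\<lambda>_. 1"
      by unfold_locales (use all_digits_sum in \<open>auto simp: field_simps\<close>)
    show ?thesis
      by (rule AE_cosine_limit_integrable[of "1/2"]) (auto simp: power_divide)
  qed
  then have 1: "AE l in lborel. \<forall>n. l \<in> {1/2 + 1 / real (Suc n + 10)..16/25} \<longrightarrow> char_energy l < \<infinity>"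
    by (subst AE_all_countable) blast
  interpret P: parameter_average "16/25" "442/625" "1/10" two_of_three
    by unfold_locales (use two_of_three_sum in \<open>auto simp: two_of_three_def\<close>)
  have 2: "AE l in lborel. l \<in> {16/25..442/625} \<longrightarrow> (\<integral>\<^sup>+t. cosine_limit two_of_three l t \<partial>lborel) < \<infinity>"
    by (rule P.AE_cosine_limit_integrable[of "63/100"]) (use two_of_three_prod in auto)
  have le: "char_energy l \<le> (\<integral>\<^sup>+t. cosine_limit two_of_three l t \<partial>lborel)" for l
    by (intro nn_integral_mono cosine_limit_all_digits_le) (auto simp: two_of_three_def)
  from 1 2 show ?thesis
  proof eventually_elim
    case (elim l)
    show ?case
    proof (intro impI)
      assume l: "l \<in> {1/2<..442/625}"
      show "char_energy l < \<infinity>"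
      proof (cases "l \<le> 16/25")
        case True
        obtain n where "inverse (real (Suc n)) < l - 1/2" using reals_Archimedean[of "l - 1/2"] l by auto
        moreover have "1 / real (Suc n + 10) \<le> inverse (real (Suc n))"
          by (simp add: field_simps)
        ultimately show ?thesis using elim(1) True by (auto dest!: spec[of _ n])
      next
        case False
        then show ?thesis using elim(2) l le[of l] by (auto simp: le_less_trans)
      qed
    qed
  qed
qed

text \<open>
  Squaring a parameter repeatedly until it is at most \<open>442/625\<close> leaves it above \<open>1/2\<close>, as
  \<open>(442/625)\<^sup>2 > 1/2\<close>. So an exceptional parameter is a root of order \<open>2 ^ j\<close> of an
  exceptional parameter in \<open>(1/2, 442/625]\<close>, and taking roots maps null sets to null sets.
\<close>
lemma AE_char_energy_finite:
  "AE l in lborel. l \<in> {1/2<..<1} \<longrightarrow> char_energy l < \<infinity>"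
proof -
  define B where "B = {l \<in> {1/2<..442/625}. char_energy l = \<infinity>}"
  have [measurable]: "char_energy \<in> borel_measurable borel" by measurable
  have Bm [measurable]: "B \<in> sets borel" unfolding B_def by measurable
  have "AE l in lborel. l \<notin> B"
    using AE_char_energy_base by eventually_elim (auto simp: B_def)
  then have "B \<in> null_sets lborel" using AE_iff_null_sets[of B lborel] by simp
  then have negB: "negligible B" by (simp add: negligible_iff_null_sets null_sets_completionI)
  define C where "C = (\<Union>j. root (2 ^ j) ` B)"
  have "negligible (root (2 ^ j) ` B)" for j
  proof (rule negligible_differentiable_image_negligible[OF order_refl negB])
    have "(root (2 ^ j) has_real_derivative inverse (real (2 ^ j) * root (2 ^ j) x ^ (2 ^ j - Suc 0))) (at x)" if "x \<in> B" for x
      using that by (intro DERIV_real_root) (auto simp: B_def)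
    then show "root (2 ^ j) differentiable_on B"
      unfolding differentiable_on_def
      by (meson differentiable_at_withinI real_differentiable_def)
  qed
  then have negC: "negligible C" unfolding C_def by (intro negligible_countable_Union) auto
  define E where "E = {l \<in> {1/2<..<1}. char_energy l = \<infinity>}"
  have Em: "E \<in> sets borel" unfolding E_def by measurable
  have "E \<subseteq> C"
  proof
    fix l assume l: "l \<in> E"
    then have l01: "1/2 < l" "l < 1" by (auto simp: E_def)
    have "\<exists>j. l ^ (2 ^ j) \<le> 442/625"
    proof -
      obtain n where "l ^ n < 442/625" using real_arch_pow_inv[of "442/625" l] l01 by auto
      moreover have "l ^ (2 ^ n) \<le> l ^ n" using l01 less_exp[of n] by (intro power_decreasing) auto
      ultimately show ?thesis by (intro exI[of _ n]) auto
    qed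
    then obtain j where j: "l ^ (2 ^ j) \<le> 442/625" "\<And>i. i < j \<Longrightarrow> \<not> l ^ (2 ^ i) \<le> 442/625"
      using exists_least_iff[of "\<lambda>j. l ^ (2 ^ j) \<le> 442/625"] by blast
    have "1/2 < l ^ (2 ^ j)"
    proof (cases j)
      case 0 then show ?thesis using l01 by simp
    next
      case (Suc i)
      have "(442/625 :: real)\<^sup>2 < (l ^ (2 ^ i))\<^sup>2" using j(2)[of i] Suc by (intro power_strict_mono) auto
      then show ?thesis by (simp add: Suc power_mult[symmetric] mult.commute power_divide)
    qed
    moreover have "char_energy (l ^ (2 ^ j)) = \<infinity>"
      using char_energy_iterate_le[of l j] l by (auto simp: E_def top_unique)
    ultimately have "l ^ (2 ^ j) \<in> B" using j by (simp add: B_def)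
    moreover have "l = root (2 ^ j) (l ^ (2 ^ j))" using l01 by (simp add: real_root_power_cancel)
    ultimately show "l \<in> C" unfolding C_def by blast
  qed
  then have "E \<in> null_sets lebesgue" using negC negligible_subset negligible_iff_null_sets by blast
  then have "E \<in> null_sets lborel" using Em by (simp add: null_sets_completion_iff)
  from AE_not_in[OF this] show ?thesis
    by eventually_elim (auto simp: E_def less_top)
qed

section \<open>Measures with square integrable characteristic function\<close>

lemma norm_char_power2:
  assumes "real_distribution M"
  shows "(LINT x|M. LINT y|M. cos (t * (x - y))) = (cmod (char M t))\<^sup>2"
proof -
  interpret real_distribution M by fact
  have int: "integrable M (\<lambda>x. cos (t * x))" "integrable M (\<lambda>x. sin (t * x))"
    by (rule integrable_const_bound[where B = 1]; simp)+
  have "Re (char M t) = (LINT x|M. Re (iexp (t * x)))" "Im (char M t) = (LINT x|M. Im (iexp (t * x)))"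
    unfolding char_def
    by (subst integral_Re integral_Im, rule integrable_const_bound[where B=1]; simp)+
  then have reim: "Re (char M t) = (LINT x|M. cos (t * x))" "Im (char M t) = (LINT x|M. sin (t * x))"
    by (simp_all add: Re_exp Im_exp)
  have "(LINT x|M. LINT y|M. cos (t * (x - y)))
      = (LINT x|M. LINT y|M. cos (t * x) * cos (t * y) + sin (t * x) * sin (t * y))"
    by (simp add: right_diff_distrib cos_diff)
  also have "\<dots> = (LINT x|M. cos (t * x) * Re (char M t) + sin (t * x) * Im (char M t))"
    using int by (simp add: reim)
  also have "\<dots> = Re (char M t) * Re (char M t) + Im (char M t) * Im (char M t)"
    using int by (simp add: reim)
  finally show ?thesis by (simp add: cmod_power2) (simp add: power2_eq_square)
qed

lemma gaussian_energy_eq_char: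
  assumes "real_distribution M"
  shows "(LINT x|M. LINT y|M. exp (- ((x - y) / r)\<^sup>2 / 2))
      = (LINT s|std_normal_distribution. (cmod (char M (s / r)))\<^sup>2)"
proof -
  interpret real_distribution M by fact
  interpret N: real_distribution std_normal_distribution by (rule real_dist_normal_dist)
  interpret MM: pair_prob_space M M ..
  interpret MMN: pair_prob_space "M \<Otimes>\<^sub>M M" std_normal_distribution ..
  have sets3: "sets ((M \<Otimes>\<^sub>M M) \<Otimes>\<^sub>M std_normal_distribution) = sets ((borel \<Otimes>\<^sub>M borel) \<Otimes>\<^sub>M borel)"
    by (intro sets_pair_measure_cong) auto
  have "(\<lambda>z :: (real \<times> real) \<times> real. cos (snd z / r * (fst (fst z) - snd (fst z))))
      \<in> borel_measurable ((borel \<Otimes>\<^sub>M borel) \<Otimes>\<^sub>M borel)"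
    by measurable
  then have meas: "(\<lambda>z. cos (snd z / r * (fst (fst z) - snd (fst z))))
      \<in> borel_measurable ((M \<Otimes>\<^sub>M M) \<Otimes>\<^sub>M std_normal_distribution)"
    by (subst measurable_cong_sets[OF sets3 refl])
  have int3: "integrable ((M \<Otimes>\<^sub>M M) \<Otimes>\<^sub>M std_normal_distribution)
      (\<lambda>(z, s). cos (s / r * (fst z - snd z)))"
    by (rule MMN.P.integrable_const_bound[where B = 1]) (use meas in \<open>auto simp: case_prod_unfold\<close>)
  have int2: "integrable (M \<Otimes>\<^sub>M M) (\<lambda>z. cos (s / r * (fst z - snd z)))" for s
    by (rule MM.P.integrable_const_bound[where B = 1]) auto
  have int2': "integrable (M \<Otimes>\<^sub>M M) (\<lambda>z. exp (- ((fst z - snd z) / r)\<^sup>2 / 2))"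
    by (rule MM.P.integrable_const_bound[where B = 1]) auto
  have "(LINT x|M. LINT y|M. exp (- ((x - y) / r)\<^sup>2 / 2))
      = (LINT z|(M \<Otimes>\<^sub>M M). exp (- ((fst z - snd z) / r)\<^sup>2 / 2))"
    using MM.integral_fst'[OF int2'] by simp
  also have "\<dots> = (LINT z|(M \<Otimes>\<^sub>M M). LINT s|std_normal_distribution. cos (s / r * (fst z - snd z)))"
    using gauss_cos_integral[of "(fst z - snd z) / r" for z] by (simp add: ac_simps)
  also have "\<dots> = (LINT s|std_normal_distribution. LINT z|(M \<Otimes>\<^sub>M M). cos (s / r * (fst z - snd z)))"
    by (rule MMN.Fubini_integral[symmetric, OF int3])
  also have "\<dots> = (LINT s|std_normal_distribution. (cmod (char M (s / r)))\<^sup>2)"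
  proof (rule Bochner_Integration.integral_cong[OF refl])
    fix s
    show "(LINT z|(M \<Otimes>\<^sub>M M). cos (s / r * (fst z - snd z))) = (cmod (char M (s / r)))\<^sup>2"
      using norm_char_power2[OF assms, of "s / r"] MM.integral_fst'[OF int2[of s]] by simp
  qed
  finally show ?thesis .
qed

text \<open>
  The indicator of \<open>\<bar>x - y\<bar> \<le> 2 r\<close> is at most \<open>exp 2\<close> times the Gaussian \<open>exp (- ((x - y) / r)\<^sup>2 / 2)\<close>, whose integral is an
  average of \<open>\<bar>char M\<bar>\<^sup>2\<close> at frequencies of order \<open>1 / r\<close>.
\<close>
lemma close_pairs_bound:
  assumes "real_distribution M" and r: "0 < r" and K0: "0 \<le> K"
    and K: "(\<integral>\<^sup>+t. ennreal ((cmod (char M t))\<^sup>2) \<partial>lborel) \<le> ennreal K"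
  shows "emeasure (M \<Otimes>\<^sub>M M) {z. \<bar>fst z - snd z\<bar> \<le> 2 * r} \<le> ennreal (exp 2 * (r * K))"
proof -
  interpret real_distribution M by fact
  interpret MM: pair_prob_space M M ..
  have int2': "integrable (M \<Otimes>\<^sub>M M) (\<lambda>z. exp (- ((fst z - snd z) / r)\<^sup>2 / 2))"
    by (rule MM.P.integrable_const_bound[where B = 1]) auto
  have [measurable]: "char M \<in> borel_measurable borel" by (rule borel_measurable_continuous_onI) (auto intro!: continuous_at_imp_continuous_on isCont_char)
  have pred: "{z. \<bar>fst z - snd z\<bar> \<le> 2 * r} \<in> sets (M \<Otimes>\<^sub>M M)"
  proof -
    have "{z \<in> space (M \<Otimes>\<^sub>M M). \<bar>fst z - snd z\<bar> \<le> 2 * r} \<in> sets (M \<Otimes>\<^sub>M M)" by measurable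
    then show ?thesis by (simp add: space_pair_measure)
  qed
  have "emeasure (M \<Otimes>\<^sub>M M) {z. \<bar>fst z - snd z\<bar> \<le> 2 * r}
      = (\<integral>\<^sup>+z. indicator {z. \<bar>fst z - snd z\<bar> \<le> 2 * r} z \<partial>(M \<Otimes>\<^sub>M M))"
    using pred by simp
  also have "\<dots> \<le> (\<integral>\<^sup>+z. ennreal (exp 2) * ennreal (exp (- ((fst z - snd z) / r)\<^sup>2 / 2)) \<partial>(M \<Otimes>\<^sub>M M))"
  proof (rule nn_integral_mono)
    fix z :: "real \<times> real"
    have "1 \<le> exp 2 * exp (- ((fst z - snd z) / r)\<^sup>2 / 2)" if "\<bar>fst z - snd z\<bar> \<le> 2 * r"
    proof -
      have "\<bar>(fst z - snd z) / r\<bar> \<le> \<bar>2\<bar>" using that r by (simp add: abs_divide field_simps)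
      then have "((fst z - snd z) / r)\<^sup>2 \<le> 2\<^sup>2" by (simp only: abs_le_square_iff)
      then show ?thesis by (simp add: exp_add[symmetric])
    qed
    then have "ennreal 1 \<le> ennreal (exp 2 * exp (- ((fst z - snd z) / r)\<^sup>2 / 2))" if "\<bar>fst z - snd z\<bar> \<le> 2 * r"
      using that by (intro ennreal_leI) auto
    then show "indicator {z. \<bar>fst z - snd z\<bar> \<le> 2 * r} z
        \<le> ennreal (exp 2) * ennreal (exp (- ((fst z - snd z) / r)\<^sup>2 / 2))"
      by (auto simp: ennreal_mult split: split_indicator)
  qed
  also have "\<dots> = ennreal (exp 2) * ennreal (LINT z|(M \<Otimes>\<^sub>M M). exp (- ((fst z - snd z) / r)\<^sup>2 / 2))"
    using int2' by (subst nn_integral_cmult) (auto simp: nn_integral_eq_integral)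
  also have "(LINT z|(M \<Otimes>\<^sub>M M). exp (- ((fst z - snd z) / r)\<^sup>2 / 2))
      = (LINT s|std_normal_distribution. (cmod (char M (s / r)))\<^sup>2)"
    using MM.integral_fst'[OF int2'] gaussian_energy_eq_char[OF assms(1), of r] by simp
  also have "ennreal \<dots> \<le> ennreal (r * K)"
  proof -
    have "(\<integral>\<^sup>+s. ennreal ((cmod (char M (s / r)))\<^sup>2) \<partial>std_normal_distribution)
        = (\<integral>\<^sup>+s. ennreal (std_normal_density s) * ennreal ((cmod (char M (s / r)))\<^sup>2) \<partial>lborel)"
      by (rule nn_integral_density) measurable
    also have "\<dots> \<le> (\<integral>\<^sup>+s. ennreal ((cmod (char M (s / r)))\<^sup>2) \<partial>lborel)"
    proof (rule nn_integral_mono)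
      fix s
      have "std_normal_density s \<le> 1"
        unfolding std_normal_density_def using pi_gt3 by (intro mult_le_one) auto
      then have "ennreal (std_normal_density s) * ennreal ((cmod (char M (s / r)))\<^sup>2) \<le> 1 * ennreal ((cmod (char M (s / r)))\<^sup>2)"
        by (intro mult_right_mono) (auto simp: ennreal_le_1)
      then show "ennreal (std_normal_density s) * ennreal ((cmod (char M (s / r)))\<^sup>2) \<le> ennreal ((cmod (char M (s / r)))\<^sup>2)"
        by simp
    qed
    also have "\<dots> = ennreal r * (\<integral>\<^sup>+t. ennreal ((cmod (char M t))\<^sup>2) \<partial>lborel)"
      using nn_integral_real_affine[of "\<lambda>s. ennreal ((cmod (char M (s / r)))\<^sup>2)" r 0] r by simp
    also have "\<dots> \<le> ennreal r * ennreal K" by (intro mult_left_mono K) simp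
    also have "\<dots> = ennreal (r * K)" using r K0 by (simp add: ennreal_mult)
    finally show ?thesis using r K0 by (intro ennreal_leI integral_real_bounded) auto
  qed
  then have "ennreal (exp 2) * ennreal (LINT s|std_normal_distribution. (cmod (char M (s / r)))\<^sup>2)
      \<le> ennreal (exp 2) * ennreal (r * K)" by (rule mult_left_mono) simp
  finally show ?thesis by (simp add: ennreal_mult')
qed

text \<open>
  The uniform distribution on \<open>[-r, r]\<close> smooths \<open>M\<close> to a measure with density \<open>m / (2 r)\<close>, where \<open>m x\<close> is the
  measure of \<open>[x - r, x + r]\<close>. The \<open>L\<^sup>2\<close> norm of this density is controlled by the pairs at
  distance at most \<open>2 r\<close>, so Cauchy-Schwarz bounds the smoothed mass of \<open>U\<close>. As \<open>U\<close> is open, letting \<open>r\<close> tend to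
  \<open>0\<close> recovers at least the mass of \<open>U\<close> under \<open>M\<close> by Fatou's lemma.
\<close>
lemma open_set_bound:
  assumes "real_distribution M"
    and C: "\<And>r. 0 < r \<Longrightarrow> emeasure (M \<Otimes>\<^sub>M M) {z. \<bar>fst z - snd z\<bar> \<le> 2 * r} \<le> ennreal (C * r)"
    and U: "open U"
  shows "(emeasure M U)\<^sup>2 \<le> ennreal C * emeasure lborel U"
proof -
  interpret real_distribution M by fact
  interpret MM: pair_prob_space M M ..
  interpret LM: pair_sigma_finite M lborel ..
  interpret LMM: pair_sigma_finite "M \<Otimes>\<^sub>M M" lborel ..
  have [measurable]: "U \<in> sets borel" using U by simp
  have avg: "(\<integral>\<^sup>+y. ennreal (1 / (2 * r)) * emeasure lborel (U \<inter> {y - r..y + r}) \<partial>M)\<^sup>2 \<le> ennreal C * emeasure lborel U"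
    if r: "0 < r" for r
  proof -
    define H where "H = (\<lambda>x y. indicator {z. \<bar>fst z - snd z\<bar> \<le> r} (x, y) :: ennreal)"
    have [measurable]: "{z :: real \<times> real. \<bar>fst z - snd z\<bar> \<le> r} \<in> sets (borel \<Otimes>\<^sub>M borel)"
    proof -
      have "{z \<in> space (borel \<Otimes>\<^sub>M borel). \<bar>fst z - snd z :: real\<bar> \<le> r} \<in> sets (borel \<Otimes>\<^sub>M borel)" by measurable
      then show ?thesis by (simp add: space_pair_measure)
    qed
    have [measurable (raw)]: "f \<in> borel_measurable N \<Longrightarrow> g \<in> borel_measurable N \<Longrightarrow> (\<lambda>x. H (f x) (g x)) \<in> borel_measurable N"
      for f g and N :: "'z measure"
      unfolding H_def by measurable
    define m where "m x = (\<integral>\<^sup>+y. H x y \<partial>M)" for x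
    have [measurable]: "m \<in> borel_measurable borel" unfolding m_def by measurable
    have "(\<integral>\<^sup>+y. ennreal (1 / (2 * r)) * emeasure lborel (U \<inter> {y - r..y + r}) \<partial>M)
        = ennreal (1 / (2 * r)) * (\<integral>\<^sup>+y. (\<integral>\<^sup>+x. indicator U x * H x y \<partial>lborel) \<partial>M)"
    proof -
      have "emeasure lborel (U \<inter> {y - r..y + r}) = (\<integral>\<^sup>+x. indicator U x * H x y \<partial>lborel)" for y
      proof -
        have "emeasure lborel (U \<inter> {y - r..y + r}) = (\<integral>\<^sup>+x. indicator (U \<inter> {y - r..y + r}) x \<partial>lborel)"
          by simp
        also have "\<dots> = (\<integral>\<^sup>+x. indicator U x * H x y \<partial>lborel)"
          by (intro nn_integral_cong) (auto simp: H_def abs_le_iff split: split_indicator)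
        finally show ?thesis .
      qed
      then show ?thesis by (simp add: nn_integral_cmult)
    qed
    also have "(\<integral>\<^sup>+y. (\<integral>\<^sup>+x. indicator U x * H x y \<partial>lborel) \<partial>M) = (\<integral>\<^sup>+x. (\<integral>\<^sup>+y. indicator U x * H x y \<partial>M) \<partial>lborel)"
      by (rule LM.Fubini'[symmetric]) measurable
    also have "\<dots> = (\<integral>\<^sup>+x. m x * indicator U x \<partial>lborel)"
      unfolding m_def by (intro nn_integral_cong, subst nn_integral_cmult) (auto simp: mult.commute)
    finally have eq: "(\<integral>\<^sup>+y. ennreal (1 / (2 * r)) * emeasure lborel (U \<inter> {y - r..y + r}) \<partial>M)
        = ennreal (1 / (2 * r)) * (\<integral>\<^sup>+x. m x * indicator U x \<partial>lborel)" .
    have m2: "(\<integral>\<^sup>+x. (m x)\<^sup>2 \<partial>lborel) \<le> ennreal (2 * r) * ennreal (C * r)"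
    proof -
      have "(m x)\<^sup>2 = (\<integral>\<^sup>+z. H x (fst z) * H x (snd z) \<partial>(M \<Otimes>\<^sub>M M))" for x
        by (subst nn_integral_fst[symmetric]) (auto simp: nn_integral_cmult nn_integral_multc m_def power2_eq_square)
      then have "(\<integral>\<^sup>+x. (m x)\<^sup>2 \<partial>lborel) = (\<integral>\<^sup>+x. (\<integral>\<^sup>+z. H x (fst z) * H x (snd z) \<partial>(M \<Otimes>\<^sub>M M)) \<partial>lborel)"
        by simp
      also have "\<dots> = (\<integral>\<^sup>+z. (\<integral>\<^sup>+x. H x (fst z) * H x (snd z) \<partial>lborel) \<partial>(M \<Otimes>\<^sub>M M))"
        by (rule LMM.Fubini') measurable
      also have "\<dots> \<le> (\<integral>\<^sup>+z. ennreal (2 * r) * indicator {z. \<bar>fst z - snd z\<bar> \<le> 2 * r} z \<partial>(M \<Otimes>\<^sub>M M))"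
      proof (rule nn_integral_mono)
        fix z :: "real \<times> real"
        have "(\<integral>\<^sup>+x. H x (fst z) * H x (snd z) \<partial>lborel)
            \<le> (\<integral>\<^sup>+x. indicator {z. \<bar>fst z - snd z\<bar> \<le> 2 * r} z * indicator {fst z - r..fst z + r} x \<partial>lborel)"
          by (intro nn_integral_mono) (auto simp: H_def split: split_indicator)
        also have "\<dots> = indicator {z. \<bar>fst z - snd z\<bar> \<le> 2 * r} z * ennreal (2 * r)"
          using r by (simp add: nn_integral_cmult)
        finally show "(\<integral>\<^sup>+x. H x (fst z) * H x (snd z) \<partial>lborel)
            \<le> ennreal (2 * r) * indicator {z. \<bar>fst z - snd z\<bar> \<le> 2 * r} z" by (simp add: mult.commute)
      qed
      also have "\<dots> = ennreal (2 * r) * emeasure (M \<Otimes>\<^sub>M M) {z. \<bar>fst z - snd z\<bar> \<le> 2 * r}"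
      proof (rule nn_integral_cmult_indicator)
        have "{z \<in> space (M \<Otimes>\<^sub>M M). \<bar>fst z - snd z\<bar> \<le> 2 * r} \<in> sets (M \<Otimes>\<^sub>M M)" by measurable
        then show "{z. \<bar>fst z - snd z\<bar> \<le> 2 * r} \<in> sets (M \<Otimes>\<^sub>M M)" by (simp add: space_pair_measure)
      qed
      also have "\<dots> \<le> ennreal (2 * r) * ennreal (C * r)" by (intro mult_left_mono C r) simp
      finally show ?thesis .
    qed
    have "(\<integral>\<^sup>+x. m x * indicator U x \<partial>lborel)\<^sup>2 \<le> (\<integral>\<^sup>+x. (m x)\<^sup>2 \<partial>lborel) * (\<integral>\<^sup>+x. (indicator U x)\<^sup>2 \<partial>lborel)"
      by (rule Cauchy_Schwarz_nn_integral) measurable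
    also have "(\<integral>\<^sup>+x. (indicator U x :: ennreal)\<^sup>2 \<partial>lborel) = emeasure lborel U"
    proof -
      have "(indicator U x :: ennreal)\<^sup>2 = indicator U x" for x by (simp split: split_indicator)
      then show ?thesis by simp
    qed
    finally have "(\<integral>\<^sup>+x. m x * indicator U x \<partial>lborel)\<^sup>2 \<le> ennreal (2 * r) * ennreal (C * r) * emeasure lborel U"
      using m2 by (meson mult_right_mono order_trans zero_le)
    then have "(ennreal (1 / (2 * r)) * (\<integral>\<^sup>+x. m x * indicator U x \<partial>lborel))\<^sup>2
        \<le> (ennreal (1 / (2 * r)))\<^sup>2 * (ennreal (2 * r) * ennreal (C * r) * emeasure lborel U)"
      by (simp add: power_mult_distrib mult_left_mono)
    also have "\<dots> = (ennreal (1 / (2 * r)))\<^sup>2 * (ennreal (2 * r) * ennreal (C * r)) * emeasure lborel U"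
      by (simp add: mult.assoc)
    also have "(ennreal (1 / (2 * r)))\<^sup>2 * (ennreal (2 * r) * ennreal (C * r)) \<le> ennreal C"
    proof -
      have "ennreal (C / 2) \<le> ennreal C" by (cases "0 \<le> C") (auto intro!: ennreal_leI simp: ennreal_neg)
      then show ?thesis
        using r by (simp add: power2_eq_square ennreal_mult'[symmetric] ennreal_mult''[symmetric])
    qed
    finally show ?thesis unfolding eq by (simp add: mult_right_mono)
  qed
  define r where "r n = 1 / real (Suc n)" for n
  have r0: "0 < r n" for n by (simp add: r_def)
  define G where "G n y = ennreal (1 / (2 * r n)) * emeasure lborel (U \<inter> {y - r n..y + r n})" for n y
  have [measurable]: "G n \<in> borel_measurable borel" for n
  proof -
    define S where "S = {z \<in> space (borel \<Otimes>\<^sub>M lborel). snd z \<in> U \<and> \<bar>snd z - fst z\<bar> \<le> r n}"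
    have "S \<in> sets (borel \<Otimes>\<^sub>M lborel)" unfolding S_def by measurable
    then have "(\<lambda>y. emeasure lborel (Pair y -` S)) \<in> borel_measurable borel"
      by (rule lborel.measurable_emeasure_Pair)
    moreover have "Pair y -` S = U \<inter> {y - r n..y + r n}" for y
      by (auto simp: S_def space_pair_measure abs_le_iff)
    ultimately have "(\<lambda>y. emeasure lborel (U \<inter> {y - r n..y + r n})) \<in> borel_measurable borel"
      by (simp only:)
    then show ?thesis unfolding G_def by (intro borel_measurable_times_ennreal borel_measurable_const)
  qed
  have ind: "indicator U y \<le> liminf (\<lambda>n. G n y)" for y
  proof (cases "y \<in> U")
    case True
    then obtain d where d: "0 < d" "ball y d \<subseteq> U" using U openE by blast
    obtain n0 where n0: "inverse (real (Suc n0)) < d" using reals_Archimedean d by blast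
    have "1 \<le> G n y" if "n0 \<le> n" for n
    proof -
      have "r n \<le> inverse (real (Suc n0))" using that by (simp add: r_def field_simps)
      then have "r n < d" using n0 by simp
      then have "{y - r n..y + r n} \<subseteq> U" using d by (auto simp: subset_eq dist_real_def abs_less_iff)
      then have "U \<inter> {y - r n..y + r n} = {y - r n..y + r n}" by auto
      then have "G n y = ennreal (1 / (2 * r n)) * ennreal (2 * r n)" using r0[of n] by (simp add: G_def)
      then show ?thesis using r0[of n] by (simp add: ennreal_mult[symmetric])
    qed
    then show ?thesis using True by (intro Liminf_bounded) (auto simp: eventually_sequentially)
  qed auto
  have "emeasure M U \<le> (\<integral>\<^sup>+y. liminf (\<lambda>n. G n y) \<partial>M)"
  proof -
    have "emeasure M U = (\<integral>\<^sup>+y. indicator U y \<partial>M)" by simp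
    also have "\<dots> \<le> (\<integral>\<^sup>+y. liminf (\<lambda>n. G n y) \<partial>M)" by (intro nn_integral_mono ind)
    finally show ?thesis .
  qed
  also have "\<dots> \<le> liminf (\<lambda>n. \<integral>\<^sup>+y. G n y \<partial>M)" by (rule nn_integral_liminf) measurable
  finally have le: "emeasure M U \<le> liminf (\<lambda>n. \<integral>\<^sup>+y. G n y \<partial>M)" .
  show ?thesis
  proof (cases "ennreal C * emeasure lborel U")
    case (real x)
    have "(\<integral>\<^sup>+y. G n y \<partial>M) \<le> ennreal (sqrt x)" for n
    proof -
      have sq: "(\<integral>\<^sup>+y. G n y \<partial>M)\<^sup>2 \<le> ennreal x" using avg[OF r0[of n]] real unfolding G_def by simp
      then show ?thesis
        by (cases "\<integral>\<^sup>+y. G n y \<partial>M") (auto simp: real ennreal_power power2_eq_square ennreal_mult[symmetric] top_unique intro!: ennreal_leI real_le_rsqrt)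
    qed
    then have "liminf (\<lambda>n. \<integral>\<^sup>+y. G n y \<partial>M) \<le> liminf (\<lambda>n. ennreal (sqrt x))"
      by (intro Liminf_mono) auto
    then have "liminf (\<lambda>n. \<integral>\<^sup>+y. G n y \<partial>M) \<le> ennreal (sqrt x)" by (simp add: Liminf_const)
    with le have "emeasure M U \<le> ennreal (sqrt x)" by (rule order_trans)
    then have "(emeasure M U)\<^sup>2 \<le> (ennreal (sqrt x))\<^sup>2" by (intro power_mono) auto
    then show ?thesis using real by (simp add: ennreal_power)
  qed simp
qed

text \<open>
  The bound for open sets extends to null sets by outer regularity of Lebesgue measure.
\<close>
lemma absolutely_continuous_if_char_square_integrable:
  assumes M: "real_distribution M" and fin: "(\<integral>\<^sup>+t. ennreal ((cmod (char M t))\<^sup>2) \<partial>lborel) < \<infinity>"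
  shows "absolutely_continuous lborel M"
  unfolding absolutely_continuous_def
proof
  interpret real_distribution M by fact
  fix N :: "real set" assume N: "N \<in> null_sets lborel"
  obtain K where K: "0 \<le> K" "(\<integral>\<^sup>+t. ennreal ((cmod (char M t))\<^sup>2) \<partial>lborel) = ennreal K"
    using fin by (cases "\<integral>\<^sup>+t. ennreal ((cmod (char M t))\<^sup>2) \<partial>lborel") auto
  define C where "C = exp 2 * K"
  have C: "emeasure (M \<Otimes>\<^sub>M M) {z. \<bar>fst z - snd z\<bar> \<le> 2 * r} \<le> ennreal (C * r)" if "0 < r" for r
    using close_pairs_bound[OF M that K(1)] K(2) by (simp add: C_def ac_simps)
  have Nb: "N \<in> sets borel" using N by auto
  have sq: "(emeasure M N)\<^sup>2 \<le> ennreal e" if e: "0 < e" for e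
  proof -
    have C0: "0 \<le> C" using K by (simp add: C_def)
    obtain U where U: "open U" "N \<subseteq> U" "emeasure lborel (U - N) < e / (C + 1)"
      using outer_regular_lborel[OF Nb, of "e / (C + 1)"] e C0 by auto
    have "emeasure lborel U = emeasure lborel (U - N)"
      using emeasure_Diff_null_set[OF N, of U] U(1) by simp
    then have Ule: "emeasure lborel U \<le> ennreal (e / (C + 1))" using U(3) by simp
    have "(emeasure M N)\<^sup>2 \<le> (emeasure M U)\<^sup>2"
      using U by (intro power_mono emeasure_mono) auto
    also have "\<dots> \<le> ennreal C * emeasure lborel U" by (rule open_set_bound[OF M C U(1)])
    also have "\<dots> \<le> ennreal C * ennreal (e / (C + 1))" by (intro mult_left_mono Ule) simp
    also have "\<dots> = ennreal (C * (e / (C + 1)))" using C0 e by (intro ennreal_mult[symmetric]) auto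
    also have "\<dots> \<le> ennreal e" using C0 e by (intro ennreal_leI) (simp add: field_simps)
    finally show ?thesis .
  qed
  have "(emeasure M N)\<^sup>2 \<le> 0"
    by (rule ennreal_le_epsilon) (use sq in auto)
  then have "emeasure M N = 0" by simp
  then show "N \<in> null_sets M" using Nb by auto
qed

section \<open>Fourier frames and Lebesgue measure\<close>

lemma measure_support_eq:
  fixes M :: "'a::second_countable_topology measure"
  assumes M: "sets M = sets borel"
  shows closed_measure_support: "closed (measure_support M)"
    and measure_support_null: "- measure_support M \<in> null_sets M"
proof -
  obtain B :: "'a set set" where B: "countable B" "topological_basis B"
    using ex_countable_basis by blast
  have eq: "- measure_support M = \<Union>{b \<in> B. emeasure M b = 0}"
  proof (intro equalityI subsetI)
    fix x assume "x \<in> - measure_support M"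
    then obtain U where U: "open U" "x \<in> U" "emeasure M U = 0"
      by (auto simp: measure_support_def)
    then obtain b where b: "b \<in> B" "x \<in> b" "b \<subseteq> U"
      using topological_basisE[OF B(2)] by metis
    have "emeasure M b \<le> emeasure M U" using b U M by (intro emeasure_mono) auto
    then show "x \<in> \<Union>{b \<in> B. emeasure M b = 0}" using b U by auto
  next
    fix x assume "x \<in> \<Union>{b \<in> B. emeasure M b = 0}"
    then show "x \<in> - measure_support M"
      using topological_basis_open[OF B(2)] by (fastforce simp: measure_support_def)
  qed
  have "open (- measure_support M)"
    unfolding eq using topological_basis_open[OF B(2)] by auto
  then show "closed (measure_support M)" by (simp add: closed_def)
  have "countable {b \<in> B. emeasure M b = 0}" using B(1) by simp
  moreover have "b \<in> null_sets M" if "b \<in> {b \<in> B. emeasure M b = 0}" for b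
    using that topological_basis_open[OF B(2)] M by auto
  ultimately have "(\<Union>b\<in>{b \<in> B. emeasure M b = 0}. b) \<in> null_sets M"
    by (rule null_sets_UN')
  then show "- measure_support M \<in> null_sets M" unfolding eq by simp
qed

lemma integral_restrict_measure_support:
  fixes f :: "real \<Rightarrow> 'b::{banach, second_countable_topology}"
  assumes M: "sets M = sets borel" and [measurable]: "f \<in> borel_measurable borel"
  shows "integral\<^sup>L (restrict_space M (measure_support M)) f = integral\<^sup>L M f"
proof -
  have [measurable]: "measure_support M \<in> sets borel" using closed_measure_support[OF M] by simp
  have sM [measurable_cong]: "sets M = sets borel" by (rule M)
  have "integral\<^sup>L (restrict_space M (measure_support M)) f = (LINT x|M. indicator (measure_support M) x *\<^sub>R f x)"
    using M by (intro integral_restrict_space) (simp add: sets_eq_imp_space_eq[OF M])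
  also have "\<dots> = integral\<^sup>L M f"
    using AE_not_in[OF measure_support_null[OF M]] by (intro integral_cong_AE) (auto split: split_indicator)
  finally show ?thesis .
qed

definition character :: "real \<Rightarrow> real \<Rightarrow> complex" where
  "character \<xi> x = exp (- 2 * of_real pi * \<i> * of_real \<xi> * of_real x)"

lemma character_measurable [measurable (raw)]:
  "f \<in> borel_measurable M \<Longrightarrow> (\<lambda>x. character \<xi> (f x)) \<in> borel_measurable M"
  unfolding character_def by measurable

lemma norm_character [simp]: "cmod (character \<xi> x) = 1"
  unfolding character_def by (simp add: norm_exp_eq_Re)

lemma character_add: "character \<xi> (x + y) = character \<xi> x * character \<xi> y"
  unfolding character_def by (simp add: exp_add[symmetric] algebra_simps)

text \<open>
  Testing the frame inequalities on bounded functions is enough for what follows. All of these are square integrable, and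
  their integrals over the support can be replaced by integrals over the line.
\<close>
definition bounded_frame_bounds :: "real measure \<Rightarrow> real set \<Rightarrow> real \<Rightarrow> real \<Rightarrow> bool" where
  "bounded_frame_bounds M \<Lambda> A B \<longleftrightarrow> (\<forall>f \<in> borel_measurable borel. bounded (range f) \<longrightarrow>
     ennreal (A * (LINT x|M. (cmod (f x))\<^sup>2))
        \<le> (\<Sum>\<^sub>\<infinity>\<xi>\<in>\<Lambda>. ennreal ((cmod (LINT x|M. f x * character \<xi> x))\<^sup>2)) \<and>
     (\<Sum>\<^sub>\<infinity>\<xi>\<in>\<Lambda>. ennreal ((cmod (LINT x|M. f x * character \<xi> x))\<^sup>2))
        \<le> ennreal (B * (LINT x|M. (cmod (f x))\<^sup>2)))"

lemma fourier_frame_bounded_frame_bounds: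
  assumes M: "prob_space M" "sets M = sets borel"
    and frame: "is_fourier_frame (measure_support M) M \<Lambda>"
  obtains A B where "0 < A" "0 \<le> B" "bounded_frame_bounds M \<Lambda> A B"
proof -
  interpret prob_space M by fact
  let ?K = "measure_support M"
  from frame obtain A B where AB: "0 < A" "A \<le> B" and bounds: "\<And>f. f \<in> L2_functions ?K M \<Longrightarrow>
      ennreal (A * (LINT x|restrict_space M ?K. (cmod (f x))\<^sup>2))
             \<le> (\<Sum>\<^sub>\<infinity>\<xi>\<in>\<Lambda>. ennreal ((cmod (fourier_coefficient ?K M f \<xi>))\<^sup>2)) \<and>
           (\<Sum>\<^sub>\<infinity>\<xi>\<in>\<Lambda>. ennreal ((cmod (fourier_coefficient ?K M f \<xi>))\<^sup>2))
             \<le> ennreal (B * (LINT x|restrict_space M ?K. (cmod (f x))\<^sup>2))"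
    unfolding is_fourier_frame_def by blast
  have Ks: "?K \<in> sets M" using closed_measure_support[OF M(2)] M(2) by simp
  have "bounded_frame_bounds M \<Lambda> A B"
    unfolding bounded_frame_bounds_def
  proof (intro ballI impI)
    fix f :: "real \<Rightarrow> complex" assume f [measurable]: "f \<in> borel_measurable borel" and bdd: "bounded (range f)"
    have sM [measurable_cong]: "sets M = sets borel" by (rule M(2))
    obtain b where b: "\<And>x. cmod (f x) \<le> b" using bdd by (auto simp: bounded_iff)
    have "(cmod (f x))\<^sup>2 \<le> b\<^sup>2" for x by (rule power_mono[OF b]) simp
    then have intM: "integrable M (\<lambda>x. (cmod (f x))\<^sup>2)"
      by (intro integrable_const_bound[where B = "b\<^sup>2"]) auto
    have "integrable (restrict_space M ?K) (\<lambda>x. (cmod (f x))\<^sup>2)"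
      using integrable_mult_indicator[OF Ks intM] Ks by (simp add: integrable_restrict_space)
    moreover have "f \<in> borel_measurable (restrict_space M ?K)"
      by (intro measurable_restrict_space1) measurable
    ultimately have fL: "f \<in> L2_functions ?K M" by (simp add: L2_functions_def)
    have coeff: "fourier_coefficient ?K M f \<xi> = (LINT x|M. f x * character \<xi> x)" for \<xi>
      unfolding fourier_coefficient_def character_def[symmetric]
      by (rule integral_restrict_measure_support[OF M(2)]) measurable
    have norm: "(LINT x|restrict_space M ?K. (cmod (f x))\<^sup>2) = (LINT x|M. (cmod (f x))\<^sup>2)"
      by (rule integral_restrict_measure_support[OF M(2)]) measurable
    show "ennreal (A * (LINT x|M. (cmod (f x))\<^sup>2))
        \<le> (\<Sum>\<^sub>\<infinity>\<xi>\<in>\<Lambda>. ennreal ((cmod (LINT x|M. f x * character \<xi> x))\<^sup>2)) \<and>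
     (\<Sum>\<^sub>\<infinity>\<xi>\<in>\<Lambda>. ennreal ((cmod (LINT x|M. f x * character \<xi> x))\<^sup>2))
        \<le> ennreal (B * (LINT x|M. (cmod (f x))\<^sup>2))"
      using bounds[OF fL] unfolding coeff norm .
  qed
  with AB that[of A B] show thesis by simp
qed

text \<open>
  For \<open>y\<close> distributed according to \<open>M\<close> and \<open>s\<close> according to Lebesgue measure, \<open>y + s\<close> is distributed according to
  Lebesgue measure. Hence the Fourier coefficient of \<open>F\<close> at \<open>\<xi>\<close> is the integral over \<open>s\<close> of \<open>character \<xi> s\<close> times the
  coefficient \<open>c \<xi> s\<close> of the function \<open>y \<mapsto> indicator F (y + s)\<close> with respect to \<open>M\<close>. Only \<open>s \<in> [-1, 1]\<close>
  matters, so Cauchy-Schwarz costs a factor \<open>2\<close>, and the upper frame bound applies for each \<open>s\<close>.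
\<close>
lemma bessel_lebesgue:
  assumes M: "prob_space M" "sets M = sets borel" and supp: "AE y in M. y \<in> {0..1}"
    and bounds: "bounded_frame_bounds M \<Lambda> A B" and B: "0 \<le> B"
    and F: "F \<in> sets borel" "F \<subseteq> {0..1}"
  shows "(\<Sum>\<^sub>\<infinity>\<xi>\<in>\<Lambda>. ennreal ((cmod (LINT x|lborel. indicator F x *\<^sub>R character \<xi> x))\<^sup>2))
    \<le> ennreal (2 * B) * emeasure lborel F"
proof -
  interpret M: prob_space M by fact
  note sM [measurable_cong] = M(2)
  note F(1) [measurable]
  define L where "L = density lborel (\<lambda>s. ennreal (indicator {-1..1 :: real} s))"
  have sL [measurable_cong]: "sets L = sets borel" by (simp add: L_def)
  have L2: "emeasure L UNIV = 2"
  proof -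
    have "emeasure L UNIV = (\<integral>\<^sup>+s. ennreal (indicator {-1..1 :: real} s) * indicator UNIV s \<partial>lborel)"
      unfolding L_def by (rule emeasure_density) auto
    also have "\<dots> = (\<integral>\<^sup>+s. indicator {-1..1::real} s \<partial>lborel)"
      by (intro nn_integral_cong) (simp split: split_indicator)
    also have "\<dots> = emeasure lborel {-1..1::real}" by (rule nn_integral_indicator) simp
    finally show ?thesis by simp
  qed
  interpret L: finite_measure L
    by (rule finite_measureI) (simp add: L2 sets_eq_imp_space_eq[OF sL])
  interpret PL: pair_sigma_finite M L ..
  interpret Mb: pair_sigma_finite M lborel ..
  interpret P: finite_measure "M \<Otimes>\<^sub>M L"
    by (intro finite_measure_pair_measure M.finite_measure_axioms L.finite_measure_axioms)
  define c where "c \<xi> s = (LINT y|M. indicator F (y + s) *\<^sub>R character \<xi> y)" for \<xi> s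
  have [measurable]: "c \<xi> \<in> borel_measurable borel" for \<xi>
    unfolding c_def by measurable
  have coeff: "(LINT x|lborel. indicator F x *\<^sub>R character \<xi> x) = (LINT s|L. character \<xi> s * c \<xi> s)" for \<xi>
  proof -
    have int: "integrable (M \<Otimes>\<^sub>M L) (\<lambda>(y, s). indicator F (y + s) *\<^sub>R character \<xi> (y + s))"
      by (rule P.integrable_const_bound[where B = 1]) (auto split: split_indicator)
    have inner: "(LINT s|L. indicator F (y + s) *\<^sub>R character \<xi> (y + s)) = (LINT x|lborel. indicator F x *\<^sub>R character \<xi> x)"
      if y: "y \<in> {0..1}" for y
    proof -
      have "(LINT s|L. indicator F (y + s) *\<^sub>R character \<xi> (y + s))
          = (LINT s|lborel. indicator {-1..1} s *\<^sub>R (indicator F (y + s) *\<^sub>R character \<xi> (y + s)))"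
        unfolding L_def by (rule integral_density) auto
      also have "\<dots> = (LINT s|lborel. indicator F (y + 1 * s) *\<^sub>R character \<xi> (y + 1 * s))"
        using y F(2) by (intro Bochner_Integration.integral_cong) (force split: split_indicator)+
      also have "\<dots> = (LINT x|lborel. indicator F x *\<^sub>R character \<xi> x)"
        using lborel_integral_real_affine[of 1 "\<lambda>x. indicator F x *\<^sub>R character \<xi> x" y] by simp
      finally show ?thesis .
    qed
    have "(LINT s|L. character \<xi> s * c \<xi> s) = (LINT s|L. LINT y|M. indicator F (y + s) *\<^sub>R character \<xi> (y + s))"
      unfolding c_def by (simp add: character_add integral_mult_right_zero[symmetric] mult.commute del: integral_mult_right_zero)
    also have "\<dots> = (LINT y|M. LINT s|L. indicator F (y + s) *\<^sub>R character \<xi> (y + s))"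
      by (rule PL.Fubini_integral[OF int])
    also have "\<dots> = (LINT y|M. (LINT x|lborel. indicator F x *\<^sub>R character \<xi> x))"
      using supp inner by (intro integral_cong_AE) auto
    also have "\<dots> = (LINT x|lborel. indicator F x *\<^sub>R character \<xi> x)"
      using M.prob_space by simp
    finally show ?thesis ..
  qed
  have cnorm: "cmod (c \<xi> s) \<le> 1" for \<xi> s
  proof -
    have "cmod (c \<xi> s) \<le> (LINT y|M. cmod (indicator F (y + s) *\<^sub>R character \<xi> y))"
      unfolding c_def by (rule integral_norm_bound)
    also have "\<dots> \<le> (LINT y|M. 1)"
      by (intro integral_mono M.integrable_const_bound[where B = 1]) (auto split: split_indicator)
    finally show ?thesis using M.prob_space by simp
  qed
  have single: "ennreal ((cmod (LINT x|lborel. indicator F x *\<^sub>R character \<xi> x))\<^sup>2) \<le> 2 * (\<integral>\<^sup>+s. ennreal ((cmod (c \<xi> s))\<^sup>2) \<partial>L)" for \<xi>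
  proof -
    have int: "integrable L (\<lambda>s. character \<xi> s * c \<xi> s)"
      by (rule L.integrable_const_bound[where B = 1]) (auto simp: norm_mult cnorm)
    have "ennreal (cmod (LINT x|lborel. indicator F x *\<^sub>R character \<xi> x)) \<le> (\<integral>\<^sup>+s. ennreal (cmod (c \<xi> s)) * 1 \<partial>L)"
      unfolding coeff using integral_norm_bound_ennreal[OF int] by (simp add: norm_mult)
    then have "(ennreal (cmod (LINT x|lborel. indicator F x *\<^sub>R character \<xi> x)))\<^sup>2 \<le> (\<integral>\<^sup>+s. ennreal (cmod (c \<xi> s)) * 1 \<partial>L)\<^sup>2"
      by (intro power_mono) auto
    also have "\<dots> \<le> (\<integral>\<^sup>+s. (ennreal (cmod (c \<xi> s)))\<^sup>2 \<partial>L) * (\<integral>\<^sup>+s. 1\<^sup>2 \<partial>L)"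
      by (rule Cauchy_Schwarz_nn_integral) measurable
    finally show ?thesis
      using L2 by (simp add: ennreal_power mult.commute sets_eq_imp_space_eq[OF sL])
  qed
  have pointwise: "(\<Sum>\<xi>\<in>\<Phi>. ennreal ((cmod (c \<xi> s))\<^sup>2)) \<le> ennreal B * (\<integral>\<^sup>+y. indicator F (y + s) \<partial>M)"
    if \<Phi>: "finite \<Phi>" "\<Phi> \<subseteq> \<Lambda>" for \<Phi> s
  proof -
    define f where "f y = (indicator F (y + s) :: complex)" for y
    have f: "f \<in> borel_measurable borel" "bounded (range f)"
      unfolding f_def by (auto simp: bounded_iff intro!: exI[of _ 1] split: split_indicator)
    have c: "c \<xi> s = (LINT y|M. f y * character \<xi> y)" for \<xi>
      unfolding c_def f_def by (intro Bochner_Integration.integral_cong) (auto split: split_indicator)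
    have "(\<Sum>\<xi>\<in>\<Phi>. ennreal ((cmod (c \<xi> s))\<^sup>2)) \<le> (\<Sum>\<^sub>\<infinity>\<xi>\<in>\<Lambda>. ennreal ((cmod (c \<xi> s))\<^sup>2))"
      using \<Phi> by (subst nonneg_infsum_complete) (auto intro!: SUP_upper)
    also have "\<dots> \<le> ennreal (B * (LINT y|M. (cmod (f y))\<^sup>2))"
      using bounds f unfolding bounded_frame_bounds_def c by blast
    also have "(LINT y|M. (cmod (f y))\<^sup>2) = (LINT y|M. indicator F (y + s))"
      unfolding f_def by (intro Bochner_Integration.integral_cong) (auto split: split_indicator)
    also have "ennreal (B * (LINT y|M. indicator F (y + s))) = ennreal B * ennreal (LINT y|M. indicator F (y + s))"
      using B by (intro ennreal_mult) auto
    also have "ennreal (LINT y|M. indicator F (y + s)) = (\<integral>\<^sup>+y. ennreal (indicator F (y + s)) \<partial>M)"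
      by (intro nn_integral_eq_integral[symmetric] M.integrable_const_bound[where B = 1]) (auto split: split_indicator)
    finally show ?thesis by (simp add: ennreal_indicator)
  qed
  have "(\<Sum>\<xi>\<in>\<Phi>. ennreal ((cmod (LINT x|lborel. indicator F x *\<^sub>R character \<xi> x))\<^sup>2)) \<le> ennreal (2 * B) * emeasure lborel F"
    if \<Phi>: "finite \<Phi>" "\<Phi> \<subseteq> \<Lambda>" for \<Phi>
  proof -
    have "(\<Sum>\<xi>\<in>\<Phi>. ennreal ((cmod (LINT x|lborel. indicator F x *\<^sub>R character \<xi> x))\<^sup>2))
        \<le> (\<Sum>\<xi>\<in>\<Phi>. 2 * (\<integral>\<^sup>+s. ennreal ((cmod (c \<xi> s))\<^sup>2) \<partial>L))"
      by (intro sum_mono single)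
    also have "\<dots> = 2 * (\<integral>\<^sup>+s. (\<Sum>\<xi>\<in>\<Phi>. ennreal ((cmod (c \<xi> s))\<^sup>2)) \<partial>L)"
      by (subst nn_integral_sum) (auto simp: sum_distrib_left)
    also have "\<dots> \<le> 2 * (\<integral>\<^sup>+s. ennreal B * (\<integral>\<^sup>+y. indicator F (y + s) \<partial>M) \<partial>L)"
      by (intro mult_left_mono nn_integral_mono pointwise \<Phi>) simp
    also have "\<dots> = 2 * (ennreal B * (\<integral>\<^sup>+s. (\<integral>\<^sup>+y. indicator F (y + s) \<partial>M) \<partial>L))"
      by (subst nn_integral_cmult) auto
    also have "(\<integral>\<^sup>+s. (\<integral>\<^sup>+y. indicator F (y + s) \<partial>M) \<partial>L) = (\<integral>\<^sup>+s. ennreal (indicator {-1..1 :: real} s) * (\<integral>\<^sup>+y. indicator F (y + s) \<partial>M) \<partial>lborel)"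
      unfolding L_def by (intro nn_integral_density) measurable
    also have "\<dots> \<le> (\<integral>\<^sup>+s. (\<integral>\<^sup>+y. indicator F (y + s) \<partial>M) \<partial>lborel)"
      by (intro nn_integral_mono) (auto split: split_indicator)
    also have "\<dots> = (\<integral>\<^sup>+y. (\<integral>\<^sup>+s. indicator F (y + s) \<partial>lborel) \<partial>M)"
      by (rule Mb.Fubini') measurable
    also have "\<dots> = (\<integral>\<^sup>+y. emeasure lborel F \<partial>M)"
    proof (intro nn_integral_cong)
      fix y
      show "(\<integral>\<^sup>+s. indicator F (y + s) \<partial>lborel) = emeasure lborel F"
        using nn_integral_real_affine[of "indicator F" 1 y] by simp
    qed
    also have "\<dots> = emeasure lborel F" using M.emeasure_space_1 by simp
    also have "2 * (ennreal B * emeasure lborel F) = ennreal (2 * B) * emeasure lborel F"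
      using B by (simp add: ennreal_mult mult.assoc)
    finally show ?thesis by (simp add: mult_left_mono)
  qed
  then show ?thesis
    by (subst nonneg_infsum_complete) (auto intro!: SUP_least)
qed

section \<open>Bernoulli convolutions\<close>

lemma emeasure_affine_image:
  fixes A :: "real set"
  assumes A: "compact A" and l: "0 < l"
  shows "emeasure lborel ((\<lambda>x. l * x + c) ` A) = ennreal l * emeasure lborel A"
proof -
  let ?B = "(\<lambda>x. l * x + c) ` A"
  have "compact ?B" using A by (intro compact_continuous_image continuous_intros)
  then have [measurable]: "?B \<in> sets borel" "A \<in> sets borel" using A by (simp_all add: borel_compact)
  have ind: "indicator ?B (c + l * x) = (indicator A x :: ennreal)" for x
    using l by (auto split: split_indicator)
  have "emeasure lborel ?B = (\<integral>\<^sup>+x. indicator ?B x \<partial>lborel)" by simp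
  also have "\<dots> = ennreal \<bar>l\<bar> * (\<integral>\<^sup>+x. indicator ?B (c + l * x) \<partial>lborel)"
    using l by (intro nn_integral_real_affine) auto
  also have "\<dots> = ennreal l * emeasure lborel A" using l by (simp add: ind)
  finally show ?thesis .
qed

locale bernoulli_measure =
  fixes l :: real and M :: "real measure"
  assumes l: "0 < l" "l < 1" and conv: "is_bernoulli_convolution l M"
begin

sublocale real_distribution M
  using conv by (auto simp: is_bernoulli_convolution_def real_distribution_def real_distribution_axioms_def
      dest: sets_eq_imp_space_eq)

lemma self_similar:
  "E \<in> sets borel \<Longrightarrow> prob E = 1/2 * prob ((\<lambda>x. l * x) -` E) + 1/2 * prob ((\<lambda>x. l * x + 1 - l) -` E)"
  using conv by (simp add: is_bernoulli_convolution_def)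

lemma vimage_sets [measurable]:
  assumes "E \<in> sets borel"
  shows "(\<lambda>x. l * x) -` E \<in> sets borel" "(\<lambda>x. l * x + 1 - l) -` E \<in> sets borel"
  using assms by (auto intro!: measurable_sets_borel[of _ borel])

text \<open>
  Both preimages of the complement of \<open>[-s, 1 + s]\<close> lie outside \<open>[- s / l, 1 + s / l]\<close>, so the mass of the complement
  is at most the mass outside an arbitrarily large interval.
\<close>
lemma prob_outside_unit:
  assumes s: "0 < s"
  shows "prob (- {-s..1 + s}) = 0"
proof -
  have step: "prob (- {-s..1 + s}) \<le> prob (- {-(s / l)..1 + s / l})" if s: "0 < s" for s
  proof -
    have sl: "l * (s / l) = s" using l by simp
    have "s \<le> s / l" using s l by (simp add: field_simps)
    have "(\<lambda>x. l * x) -` (- {-s..1 + s}) \<subseteq> - {-(s / l)..1 + s / l}"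
    proof
      fix x assume "x \<in> (\<lambda>x. l * x) -` (- {-s..1 + s})"
      then have "l * x < - s \<or> 1 + s < l * x" by auto
      then have "l * x < l * (- (s / l)) \<or> l * (1 + s / l) < l * x"
        using sl l by (auto simp: distrib_left)
      then have "x < - (s / l) \<or> 1 + s / l < x" using l by (simp only: mult_less_cancel_left_pos)
      then show "x \<in> - {-(s / l)..1 + s / l}" by auto
    qed
    moreover have "(\<lambda>x. l * x + 1 - l) -` (- {-s..1 + s}) \<subseteq> - {-(s / l)..1 + s / l}"
    proof
      fix x assume "x \<in> (\<lambda>x. l * x + 1 - l) -` (- {-s..1 + s})"
      then have "l * x + 1 - l < - s \<or> 1 + s < l * x + 1 - l" by auto
      then have "l * x < l * (- (s / l)) \<or> l * (1 + s / l) < l * x"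
        using sl l by (auto simp: distrib_left)
      then have "x < - (s / l) \<or> 1 + s / l < x" using l by (simp only: mult_less_cancel_left_pos)
      then show "x \<in> - {-(s / l)..1 + s / l}" by auto
    qed
    ultimately have "prob ((\<lambda>x. l * x) -` (- {-s..1 + s})) \<le> prob (- {-(s / l)..1 + s / l})"
      "prob ((\<lambda>x. l * x + 1 - l) -` (- {-s..1 + s})) \<le> prob (- {-(s / l)..1 + s / l})"
      by (auto intro!: finite_measure_mono)
    then show ?thesis using self_similar[of "- {-s..1 + s}"] by simp
  qed
  have iter: "prob (- {-s..1 + s}) \<le> prob (- {-(s / l ^ n)..1 + s / l ^ n})" for n
  proof (induction n)
    case (Suc n)
    note Suc
    also have "prob (- {-(s / l ^ n)..1 + s / l ^ n}) \<le> prob (- {-(s / l ^ n / l)..1 + s / l ^ n / l})"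
      using s l by (intro step) simp
    finally show ?case by (simp add: field_simps)
  qed simp
  have "decseq (\<lambda>n. - {-(s / l ^ n)..1 + s / l ^ n})"
  proof (rule antimonoI)
    fix m n :: nat assume "m \<le> n"
    then have "s / l ^ m \<le> s / l ^ n"
      using s l by (intro divide_left_mono power_decreasing) auto
    then show "- {-(s / l ^ n)..1 + s / l ^ n} \<subseteq> - {-(s / l ^ m)..1 + s / l ^ m}" by auto
  qed
  then have "(\<lambda>n. prob (- {-(s / l ^ n)..1 + s / l ^ n})) \<longlonglongrightarrow> prob (\<Inter>n. - {-(s / l ^ n)..1 + s / l ^ n})"
    by (intro finite_Lim_measure_decseq) auto
  moreover have "(\<Inter>n. - {-(s / l ^ n)..1 + s / l ^ n}) = {}"
  proof -
    have "\<exists>n. x \<in> {-(s / l ^ n)..1 + s / l ^ n}" for x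
    proof -
      obtain n where "\<bar>x\<bar> / s < (1 / l) ^ n" using real_arch_pow[of "1 / l" "\<bar>x\<bar> / s"] l by auto
      then have "\<bar>x\<bar> < s / l ^ n" using s l by (simp add: power_divide field_simps)
      then show ?thesis by (intro exI[of _ n]) auto
    qed
    then show ?thesis by fast
  qed
  ultimately have "(\<lambda>n. prob (- {-(s / l ^ n)..1 + s / l ^ n})) \<longlonglongrightarrow> 0" by simp
  then have "prob (- {-s..1 + s}) \<le> 0"
    by (rule LIMSEQ_le_const) (use iter in auto)
  then show ?thesis by (simp add: measure_le_0_iff)
qed

lemma AE_unit: "AE x in M. x \<in> {0..1}"
proof -
  have "AE x in M. \<forall>n. x \<in> {- (1 / real (Suc n))..1 + 1 / real (Suc n)}"
  proof (subst AE_all_countable, rule allI)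
    fix n
    have "- {- (1 / real (Suc n))..1 + 1 / real (Suc n)} \<in> null_sets M"
      using prob_outside_unit[of "1 / real (Suc n)"] by (intro null_setsI) (auto simp: emeasure_eq_measure)
    from AE_not_in[OF this] show "AE x in M. x \<in> {- (1 / real (Suc n))..1 + 1 / real (Suc n)}" by simp
  qed
  then show ?thesis
  proof eventually_elim
    case (elim x)
    have lim: "(\<lambda>n. 1 / real (Suc n)) \<longlonglongrightarrow> 0" by (rule LIMSEQ_Suc[OF lim_1_over_n])
    have "- 0 \<le> x"
      using elim by (intro LIMSEQ_le_const2[OF tendsto_minus[OF lim]]) auto
    moreover have "x \<le> 1 + 0"
      using elim by (intro LIMSEQ_le_const[OF tendsto_add[OF tendsto_const lim]]) auto
    ultimately show ?case by simp
  qed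
qed

lemma prob_unit: "prob {0..1} = 1"
  using AE_unit by (subst prob_eq_1) auto

text \<open>
  The map \<open>x \<mapsto> l x + 1 - l\<close> sends \<open>[0, 1]\<close> into \<open>[1 - l, 1]\<close>, so below \<open>1 - l\<close> only the map \<open>x \<mapsto> l x\<close> contributes to \<open>M\<close>.
\<close>
lemma integral_self_similar:
  fixes u :: "real \<Rightarrow> 'b::{banach, second_countable_topology}"
  assumes [measurable]: "u \<in> borel_measurable borel" and u: "\<And>x. x \<notin> {0..<1 - l} \<Longrightarrow> u x = 0"
  shows "integral\<^sup>L M u = (1/2) *\<^sub>R (LINT x|M. u (l * x))"
proof -
  let ?J = "{0..<1 - l}"
  have eq: "density M (\<lambda>x. ennreal (indicator ?J x)) = density (distr M borel (\<lambda>x. l * x)) (\<lambda>x. ennreal (indicator ?J x / 2))"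
  proof (rule measure_eqI)
    fix E assume "E \<in> sets (density M (\<lambda>x. ennreal (indicator ?J x)))"
    then have [measurable]: "E \<in> sets borel" by simp
    have upper: "prob ((\<lambda>x. l * x + 1 - l) -` (E \<inter> ?J)) = 0"
    proof -
      have "AE x in M. x \<notin> (\<lambda>x. l * x + 1 - l) -` (E \<inter> ?J)"
        using AE_unit
      proof eventually_elim
        case (elim x)
        then have "0 \<le> l * x" using l by auto
        then show ?case by auto
      qed
      then show ?thesis by (subst prob_eq_0) auto
    qed
    have "emeasure (density M (\<lambda>x. ennreal (indicator ?J x))) E = (\<integral>\<^sup>+x. ennreal (indicator ?J x) * indicator E x \<partial>M)"
      by (rule emeasure_density) auto
    also have "\<dots> = (\<integral>\<^sup>+x. indicator (E \<inter> ?J) x \<partial>M)"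
      by (intro nn_integral_cong) (simp split: split_indicator)
    also have "\<dots> = ennreal (prob (E \<inter> ?J))" by (simp add: emeasure_eq_measure)
    also have "prob (E \<inter> ?J) = 1/2 * prob ((\<lambda>x. l * x) -` (E \<inter> ?J))"
      using self_similar[of "E \<inter> ?J"] upper by simp
    also have "ennreal \<dots> = ennreal (1/2) * ennreal (prob ((\<lambda>x. l * x) -` (E \<inter> ?J)))"
      by (rule ennreal_mult) auto
    also have "\<dots> = ennreal (1/2) * emeasure (distr M borel (\<lambda>x. l * x)) (E \<inter> ?J)"
      by (simp add: emeasure_distr emeasure_eq_measure)
    also have "\<dots> = (\<integral>\<^sup>+x. ennreal (1/2) * indicator (E \<inter> ?J) x \<partial>distr M borel (\<lambda>x. l * x))"
      by (rule nn_integral_cmult_indicator[symmetric]) simp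
    also have "\<dots> = (\<integral>\<^sup>+x. ennreal (indicator ?J x / 2) * indicator E x \<partial>distr M borel (\<lambda>x. l * x))"
      by (intro nn_integral_cong) (simp split: split_indicator)
    also have "\<dots> = emeasure (density (distr M borel (\<lambda>x. l * x)) (\<lambda>x. ennreal (indicator ?J x / 2))) E"
      by (rule emeasure_density[symmetric]) auto
    finally show "emeasure (density M (\<lambda>x. ennreal (indicator ?J x))) E
      = emeasure (density (distr M borel (\<lambda>x. l * x)) (\<lambda>x. ennreal (indicator ?J x / 2))) E" .
  qed simp
  have ind: "indicator ?J x *\<^sub>R u x = u x" for x using u[of x] by (auto split: split_indicator)
  have "integral\<^sup>L M u = (LINT x|M. indicator ?J x *\<^sub>R u x)" by (simp add: ind)
  also have "\<dots> = integral\<^sup>L (density M (\<lambda>x. ennreal (indicator ?J x))) u"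
    by (rule integral_density[symmetric]) auto
  also have "\<dots> = integral\<^sup>L (density (distr M borel (\<lambda>x. l * x)) (\<lambda>x. ennreal (indicator ?J x / 2))) u"
    by (simp only: eq)
  also have "\<dots> = (LINT x|distr M borel (\<lambda>x. l * x). (indicator ?J x / 2) *\<^sub>R u x)"
    by (rule integral_density) auto
  also have "\<dots> = (LINT x|distr M borel (\<lambda>x. l * x). (1/2) *\<^sub>R u x)"
  proof (rule Bochner_Integration.integral_cong[OF refl])
    fix x show "(indicator ?J x / 2) *\<^sub>R u x = (1/2) *\<^sub>R u x"
      using u[of x] by (auto split: split_indicator)
  qed
  also have "\<dots> = (1/2) *\<^sub>R (LINT x|M. u (l * x))"
    by (subst integral_distr) auto
  finally show ?thesis .
qed

lemma integral_self_similar_iterate: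
  fixes u :: "real \<Rightarrow> 'b::{banach, second_countable_topology}"
  assumes "u \<in> borel_measurable borel" and "\<And>x. x \<notin> {0..<l ^ n * (1 - l)} \<Longrightarrow> u x = 0"
  shows "integral\<^sup>L M u = (1/2) ^ n *\<^sub>R (LINT x|M. u (l ^ n * x))"
  using assms
proof (induction n arbitrary: u)
  case (Suc n)
  note [measurable] = Suc.prems(1)
  have vanish: "u x = 0" if "x \<notin> {0..<1 - l}" for x
  proof (rule Suc.prems(2))
    have "l ^ Suc n * (1 - l) \<le> 1 - l" using l by (intro mult_left_le_one_le power_le_one) auto
    then show "x \<notin> {0..<l ^ Suc n * (1 - l)}" using that by auto
  qed
  have "integral\<^sup>L M u = (1/2) *\<^sub>R (LINT x|M. u (l * x))"
    by (rule integral_self_similar[OF Suc.prems(1) vanish])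
  also have "(LINT x|M. u (l * x)) = (1/2) ^ n *\<^sub>R (LINT x|M. u (l * (l ^ n * x)))"
  proof (rule Suc.IH)
    fix x assume "x \<notin> {0..<l ^ n * (1 - l)}"
    then have "l * x \<notin> {0..<l ^ Suc n * (1 - l)}"
      using l by (auto simp: mult.assoc zero_le_mult_iff)
    then show "u (l * x) = 0" by (rule Suc.prems(2))
  qed measurable
  finally show ?case by (simp add: mult.assoc)
qed simp

text \<open>
  Discarding the contribution of the second map gives \<open>prob {0..<t} \<ge> prob {0..<t / l} / 2\<close>, and after finitely many
  steps the interval covers the unit interval.
\<close>
lemma prob_near_zero_pos: "0 < prob {0..<1 - l}"
proof -
  have step: "1/2 * prob {0..<t / l} \<le> prob {0..<t}" for t
  proof -
    have "(\<lambda>x. l * x) -` {0..<t} = {0..<t / l}" using l by (auto simp: field_simps zero_le_mult_iff)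
    then show ?thesis using self_similar[of "{0..<t}"] by simp
  qed
  have iter: "(1/2) ^ n * prob {0..<t / l ^ n} \<le> prob {0..<t}" for n t
  proof (induction n)
    case (Suc n)
    have "(1/2) ^ Suc n * prob {0..<t / l ^ Suc n} = (1/2) ^ n * (1/2 * prob {0..<t / l ^ n / l})"
      by (simp add: mult.commute)
    also have "\<dots> \<le> (1/2) ^ n * prob {0..<t / l ^ n}" by (intro mult_left_mono step) simp
    also note Suc
    finally show ?case .
  qed simp
  obtain n where "1 / (1 - l) < (1 / l) ^ n" using real_arch_pow[of "1 / l" "1 / (1 - l)"] l by auto
  then have "1 < (1 - l) / l ^ n" using l by (simp add: power_divide field_simps)
  then have "prob {0..1} \<le> prob {0..<(1 - l) / l ^ n}" by (intro finite_measure_mono) auto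
  then have "0 < prob {0..<(1 - l) / l ^ n}" using prob_unit by simp
  then have "0 < (1/2) ^ n * prob {0..<(1 - l) / l ^ n}" by simp
  also note iter
  finally show ?thesis .
qed

text \<open>
  The sets \<open>K n\<close> of the usual Cantor construction have full measure and Lebesgue measure at most \<open>(2 l) ^ n\<close>.
\<close>
lemma not_absolutely_continuous:
  assumes "l < 1/2"
  shows "\<not> absolutely_continuous lborel M"
proof
  assume ac: "absolutely_continuous lborel M"
  define K where "K = rec_nat {0..1} (\<lambda>_ A. (\<lambda>x. l * x) ` A \<union> (\<lambda>x. l * x + (1 - l)) ` A)"
  have K0: "K 0 = {0..1}" and K_Suc: "K (Suc n) = (\<lambda>x. l * x) ` K n \<union> (\<lambda>x. l * x + (1 - l)) ` K n" for n
    by (simp_all add: K_def)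
  have comp: "compact (K n)" for n
    by (induction n) (auto simp: K0 K_Suc intro!: compact_Un compact_continuous_image continuous_intros)
  then have [measurable]: "K n \<in> sets borel" for n by (simp add: borel_compact)
  have prob_K: "prob (K n) = 1" for n
  proof (induction n)
    case (Suc n)
    have "K n \<subseteq> (\<lambda>x. l * x) -` K (Suc n)" "K n \<subseteq> (\<lambda>x. l * x + 1 - l) -` K (Suc n)"
      by (auto simp: K_Suc image_iff algebra_simps)
    then have "prob (K n) \<le> prob ((\<lambda>x. l * x) -` K (Suc n))" "prob (K n) \<le> prob ((\<lambda>x. l * x + 1 - l) -` K (Suc n))"
      using finite_measure_mono[of "K n" "(\<lambda>x. l * x) -` K (Suc n)"]
        finite_measure_mono[of "K n" "(\<lambda>x. l * x + 1 - l) -` K (Suc n)"] vimage_sets[of "K (Suc n)"]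
      by auto
    then have "1 \<le> prob (K (Suc n))" using self_similar[of "K (Suc n)"] Suc by simp
    then show ?case using prob_le_1 by (simp add: antisym)
  qed (simp add: K0 prob_unit)
  have leb: "emeasure lborel (K n) \<le> ennreal ((2 * l) ^ n)" for n
  proof (induction n)
    case (Suc n)
    have affine: "emeasure lborel ((\<lambda>x. l * x + c) ` K n) = ennreal l * emeasure lborel (K n)" for c
      by (rule emeasure_affine_image[OF comp l(1)])
    have "emeasure lborel (K (Suc n)) \<le> emeasure lborel ((\<lambda>x. l * x + 0) ` K n) + emeasure lborel ((\<lambda>x. l * x + (1 - l)) ` K n)"
      unfolding K_Suc using comp[of n]
      by (simp, intro emeasure_subadditive) (auto intro!: borel_compact compact_continuous_image continuous_intros)
    also have "\<dots> = ennreal (2 * l) * emeasure lborel (K n)"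
      unfolding affine using l by (simp add: ennreal_mult mult_2[symmetric] mult.assoc)
    also have "\<dots> \<le> ennreal (2 * l) * ennreal ((2 * l) ^ n)" by (intro mult_left_mono Suc) simp
    finally show ?case using l by (simp add: ennreal_mult[symmetric])
  qed (simp add: K0)
  let ?K = "\<Inter>n. K n"
  have "emeasure lborel ?K \<le> ennreal ((2 * l) ^ n)" for n
    using leb[of n] by (rule order_trans[rotated]) (auto intro!: emeasure_mono)
  moreover have "(\<lambda>n. ennreal ((2 * l) ^ n)) \<longlonglongrightarrow> ennreal 0"
    using l assms by (intro tendsto_ennrealI LIMSEQ_power_zero) auto
  ultimately have "emeasure lborel ?K \<le> ennreal 0" by (intro LIMSEQ_le_const) auto
  then have "?K \<in> null_sets lborel" by (intro null_setsI) auto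
  then have "?K \<in> null_sets M" using ac by (auto simp: absolutely_continuous_def)
  then have "AE x in M. x \<notin> ?K" by (rule AE_not_in)
  moreover have "AE x in M. x \<in> ?K"
    using prob_K by (simp add: AE_all_countable prob_eq_1[symmetric])
  ultimately have "AE x in M. False" by eventually_elim blast
  then show False by simp
qed

text \<open>
  On a set \<open>F\<close> where the density \<open>D\<close> is bounded below, consider \<open>\<phi> = 1 / D\<close>, so that \<open>\<phi> M\<close> is Lebesgue measure on \<open>F\<close>. Its
  copy \<open>f\<close> at scale \<open>l ^ n\<close> has squared norm proportional to \<open>2 ^ (- n)\<close>. Its Fourier coefficients are those of Lebesgue
  measure on the scaled set \<open>F'\<close>, times \<open>(2 l) ^ (- n)\<close>; by \<open>bessel_lebesgue\<close> the sum of their squares is at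
  most of order \<open>(2 l) ^ (- 2 n) l ^ n = 2 ^ (- n) (2 l) ^ (- n)\<close>. Comparison with the lower frame bound
  gives a contradiction for large \<open>n\<close> if \<open>2 l > 1\<close>.
\<close>
lemma not_admits_fourier_frame:
  assumes half: "1/2 < l" and ac: "absolutely_continuous lborel M"
  shows "\<not> admits_fourier_frame M"
proof
  assume "admits_fourier_frame M"
  then obtain \<Lambda> where "is_fourier_frame (measure_support M) M \<Lambda>" by (auto simp: admits_fourier_frame_def)
  then obtain A B where AB: "0 < A" "0 \<le> B" and bounds: "bounded_frame_bounds M \<Lambda> A B"
    using fourier_frame_bounded_frame_bounds[OF prob_space_axioms] by auto
  obtain D where D [measurable]: "D \<in> borel_measurable lborel" and RN: "AE x in lborel. RN_deriv lborel M x = ennreal (D x)"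
    and Dpos: "AE x in M. 0 < D x" and D0: "\<And>x. 0 \<le> D x"
    using sigma_finite_measure.real_RN_deriv[OF lborel.sigma_finite_measure_axioms finite_measure_axioms ac] by auto
  have dens: "M = density lborel (\<lambda>x. ennreal (D x))"
  proof -
    have "density lborel (RN_deriv lborel M) = M" by (rule sigma_finite_measure.density_RN_deriv[OF lborel.sigma_finite_measure_axioms ac]) simp
    moreover have "density lborel (RN_deriv lborel M) = density lborel (\<lambda>x. ennreal (D x))"
      using RN by (intro density_cong) auto
    ultimately show ?thesis by simp
  qed
  define J where "J = {0..<1 - l}"
  define S where "S m = {x \<in> J. 1 / real (Suc m) < D x}" for m
  have [measurable]: "J \<in> sets borel" by (simp add: J_def)
  have Sm [measurable]: "S m \<in> sets borel" for m unfolding S_def by measurable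
  have "\<exists>m. prob (S m) \<noteq> 0"
  proof (rule ccontr)
    assume "\<nexists>m. prob (S m) \<noteq> 0"
    then have "AE x in M. \<forall>m. x \<notin> S m" by (subst AE_all_countable) (simp add: prob_eq_0)
    with Dpos have "AE x in M. x \<notin> J"
    proof eventually_elim
      case (elim x)
      obtain m where "inverse (real (Suc m)) < D x" using reals_Archimedean elim(1) by blast
      then show ?case using elim(2) by (auto simp: S_def inverse_eq_divide)
    qed
    then have "prob J = 0" by (simp add: prob_eq_0)
    then show False using prob_near_zero_pos by (simp add: J_def)
  qed
  then obtain m where m: "prob (S m) \<noteq> 0" by blast
  define F where "F = S m"
  have [measurable]: "F \<in> sets borel" by (simp add: F_def)
  have F_J: "F \<subseteq> {0..<1 - l}" by (auto simp: F_def S_def J_def)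
  have F_D: "0 < D x" "1 / D x \<le> real (Suc m)" if "x \<in> F" for x
  proof -
    have "1 / real (Suc m) < D x" using that by (simp add: F_def S_def)
    moreover from this have "0 < D x" by (rule le_less_trans[rotated]) simp
    ultimately show "0 < D x" "1 / D x \<le> real (Suc m)" by (simp_all add: field_simps)
  qed
  define \<phi> where "\<phi> x = indicator F x / D x" for x
  have [measurable]: "\<phi> \<in> borel_measurable borel" unfolding \<phi>_def by measurable
  have \<phi>_bounds: "0 \<le> \<phi> x" "\<phi> x \<le> real (Suc m)" for x
    using F_D[of x] D0[of x] by (auto simp: \<phi>_def split: split_indicator)
  have \<phi>_0: "\<phi> x = 0" if "x \<notin> F" for x using that by (simp add: \<phi>_def)
  define \<kappa> where "\<kappa> = (LINT x|M. (\<phi> x)\<^sup>2)"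
  have \<phi>2_int: "integrable M (\<lambda>x. (\<phi> x)\<^sup>2)"
    using \<phi>_bounds by (intro integrable_const_bound[where B = "(real (Suc m))\<^sup>2"]) (auto intro!: power_mono)
  have "\<kappa> \<noteq> 0"
  proof
    assume "\<kappa> = 0"
    then have "AE x in M. (\<phi> x)\<^sup>2 = 0"
      unfolding \<kappa>_def using \<phi>2_int by (subst (asm) integral_nonneg_eq_0_iff_AE) auto
    then have "AE x in M. x \<notin> F"
    proof eventually_elim
      case (elim x)
      then show ?case using F_D(1)[of x] by (auto simp: \<phi>_def)
    qed
    then have "prob F = 0" by (simp add: prob_eq_0)
    then show False using m by (simp add: F_def)
  qed
  then have \<kappa>: "0 < \<kappa>" unfolding \<kappa>_def by (simp add: less_le integral_nonneg_AE)
  have main: "A * \<kappa> \<le> 2 * B * (1 / (2 * l)) ^ n" for n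
  proof -
    define F' where "F' = {x. x / l ^ n \<in> F}"
    have F'm [measurable]: "F' \<in> sets borel"
    proof -
      have "(\<lambda>x. x / l ^ n) -` F \<inter> space borel \<in> sets borel" by measurable
      then show ?thesis by (simp add: F'_def vimage_def)
    qed
    have ln: "0 < l ^ n" "l ^ n \<le> 1" using l by (auto intro: power_le_one)
    have F'_sub: "F' \<subseteq> {0..<l ^ n * (1 - l)}"
    proof
      fix x assume "x \<in> F'"
      then have "0 \<le> x / l ^ n" "x / l ^ n < 1 - l" using F_J by (auto simp: F'_def)
      then show "x \<in> {0..<l ^ n * (1 - l)}" using ln by (auto simp: zero_le_divide_iff pos_divide_less_eq mult.commute)
    qed
    have F'_unit: "F' \<subseteq> {0..1}"
    proof -
      have "l ^ n * (1 - l) \<le> 1" using l ln by (intro mult_le_one) auto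
      then show ?thesis using F'_sub by auto
    qed
    have F'_le: "emeasure lborel F' \<le> ennreal (l ^ n)"
    proof -
      have "emeasure lborel F' \<le> emeasure lborel {0..l ^ n * (1 - l)}"
        using F'_sub by (intro emeasure_mono) auto
      also have "\<dots> \<le> ennreal (l ^ n)"
        using l ln by (simp add: mult_left_le ennreal_leI)
      finally show ?thesis .
    qed
    define f where "f x = complex_of_real (\<phi> (x / l ^ n))" for x
    have f [measurable]: "f \<in> borel_measurable borel" unfolding f_def by measurable
    have f_bdd: "bounded (range f)"
      unfolding bounded_iff using \<phi>_bounds by (auto intro!: exI[of _ "real (Suc m)"] simp: f_def)
    have f_0: "f x = 0" if "x \<notin> {0..<l ^ n * (1 - l)}" for x
    proof -
      have "x \<notin> F'" using that F'_sub by auto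
      then show ?thesis by (simp add: f_def F'_def \<phi>_0)
    qed
    have norm_f: "(LINT x|M. (cmod (f x))\<^sup>2) = (1/2) ^ n * \<kappa>"
      unfolding \<kappa>_def using l ln \<phi>_bounds
      by (subst integral_self_similar_iterate[of _ n]) (auto simp: f_0, auto simp: f_def)
    have coeff: "(LINT x|M. f x * character \<xi> x)
        = ((1/2) ^ n / l ^ n) *\<^sub>R (LINT x|lborel. indicator F' x *\<^sub>R character \<xi> x)" for \<xi>
    proof -
      have "(LINT x|M. f x * character \<xi> x) = (1/2) ^ n *\<^sub>R (LINT x|M. f (l ^ n * x) * character \<xi> (l ^ n * x))"
        by (rule integral_self_similar_iterate) (auto simp: f_0)
      also have "(LINT x|M. f (l ^ n * x) * character \<xi> (l ^ n * x)) = (LINT x|M. \<phi> x *\<^sub>R character \<xi> (l ^ n * x))"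
        using l ln by (simp add: f_def scaleR_conv_of_real)
      also have "\<dots> = (LINT x|lborel. D x *\<^sub>R (\<phi> x *\<^sub>R character \<xi> (l ^ n * x)))"
        by (subst dens, rule integral_density) (auto simp: D0)
      also have "\<dots> = (LINT x|lborel. indicator F' (0 + l ^ n * x) *\<^sub>R character \<xi> (0 + l ^ n * x))"
      proof (rule Bochner_Integration.integral_cong[OF refl])
        fix x
        have "indicator F' (l ^ n * x) = (indicator F x :: real)"
          using l ln by (auto simp: F'_def split: split_indicator)
        moreover have "D x * \<phi> x = indicator F x" using F_D(1)[of x] by (auto simp: \<phi>_def split: split_indicator)
        ultimately show "D x *\<^sub>R (\<phi> x *\<^sub>R character \<xi> (l ^ n * x)) = indicator F' (0 + l ^ n * x) *\<^sub>R character \<xi> (0 + l ^ n * x)"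
          by (simp only: scaleR_scaleR add_0)
      qed
      also have "\<dots> = (1 / l ^ n) *\<^sub>R (LINT x|lborel. indicator F' x *\<^sub>R character \<xi> x)"
        using lborel_integral_real_affine[of "l ^ n" "\<lambda>x. indicator F' x *\<^sub>R character \<xi> x" 0] l ln by simp
      finally show ?thesis by simp
    qed
    have coeff2: "ennreal ((cmod (LINT x|M. f x * character \<xi> x))\<^sup>2)
        = ennreal (((1/2) ^ n / l ^ n)\<^sup>2) * ennreal ((cmod (LINT x|lborel. indicator F' x *\<^sub>R character \<xi> x))\<^sup>2)" for \<xi>
    proof -
      have "ennreal ((cmod (c *\<^sub>R z))\<^sup>2) = ennreal (c\<^sup>2) * ennreal ((cmod z)\<^sup>2)" for c z
        by (simp add: power_mult_distrib ennreal_mult)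
      then show ?thesis unfolding coeff .
    qed
    have "ennreal (A * ((1/2) ^ n * \<kappa>)) \<le> (\<Sum>\<^sub>\<infinity>\<xi>\<in>\<Lambda>. ennreal ((cmod (LINT x|M. f x * character \<xi> x))\<^sup>2))"
      using bounds f f_bdd unfolding bounded_frame_bounds_def norm_f[symmetric] by blast
    also have "\<dots> \<le> ennreal (((1/2) ^ n / l ^ n)\<^sup>2) * (\<Sum>\<^sub>\<infinity>\<xi>\<in>\<Lambda>. ennreal ((cmod (LINT x|lborel. indicator F' x *\<^sub>R character \<xi> x))\<^sup>2))"
      unfolding coeff2
      by (subst (1 2) nonneg_infsum_complete)
        (auto intro!: SUP_least mult_left_mono SUP_upper simp: sum_distrib_left[symmetric])
    also have "\<dots> \<le> ennreal (((1/2) ^ n / l ^ n)\<^sup>2) * (ennreal (2 * B) * emeasure lborel F')"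
      by (intro mult_left_mono bessel_lebesgue[OF prob_space_axioms _ AE_unit bounds AB(2) F'm F'_unit]) auto
    also have "\<dots> \<le> ennreal (((1/2) ^ n / l ^ n)\<^sup>2) * (ennreal (2 * B) * ennreal (l ^ n))"
      by (intro mult_left_mono F'_le) auto
    also have "\<dots> = ennreal (((1/2) ^ n / l ^ n)\<^sup>2 * (2 * B * l ^ n))"
      using AB ln by (simp add: ennreal_mult)
    finally have "A * ((1/2) ^ n * \<kappa>) \<le> ((1/2) ^ n / l ^ n)\<^sup>2 * (2 * B * l ^ n)"
      using AB ln by (subst (asm) ennreal_le_iff) auto
    also have "\<dots> = (1/2) ^ n * (2 * B * (1 / (2 * l)) ^ n)"
      using ln by (simp add: power_divide power_mult_distrib power2_eq_square field_simps)
    finally have "(1/2) ^ n * (A * \<kappa>) \<le> (1/2) ^ n * (2 * B * (1 / (2 * l)) ^ n)"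
      by (simp only: ac_simps)
    then show ?thesis by (subst (asm) mult_le_cancel_left_pos) auto
  qed
  have "(\<lambda>n. 2 * B * (1 / (2 * l)) ^ n) \<longlonglongrightarrow> 2 * B * 0"
    using half by (intro tendsto_intros LIMSEQ_power_zero) auto
  then have "A * \<kappa> \<le> 2 * B * 0" by (rule LIMSEQ_le_const) (use main in auto)
  then show False using AB \<kappa> by (simp add: mult_le_0_iff)
qed

text \<open>
  The equation \<open>char_bernoulli_convolution\<close>, iterated \<open>N\<close> times, extracts one factor \<open>cos\<^sup>2\<close> per step. The translation
  by \<open>1 - l\<close> of the second map accounts for the rescaled frequency.
\<close>
lemma norm_char_le_cosine_product:
  "(cmod (char M t))\<^sup>2 \<le> cosine_product (\<lambda>_. 1) {0..<N} l ((1 - l) / 2 * t)"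
proof -
  have factor: "(cmod ((1 + iexp \<theta>) / 2))\<^sup>2 = (cos (\<theta> / 2))\<^sup>2" for \<theta> :: real
  proof -
    have "(cmod (1 + iexp \<theta>))\<^sup>2 = (1 + cos \<theta>)\<^sup>2 + (sin \<theta>)\<^sup>2"
      by (simp add: cmod_power2 Re_exp Im_exp)
    also have "\<dots> = 2 + 2 * cos \<theta>"
      using sin_cos_squared_add[of \<theta>] by (simp add: power2_eq_square algebra_simps)
    also have "\<dots> = 4 * (cos (\<theta> / 2))\<^sup>2" using cos_double_cos[of "\<theta> / 2"] by simp
    finally show ?thesis by (simp add: norm_divide power_divide)
  qed
  have "(cmod (char M t))\<^sup>2 = cosine_product (\<lambda>_. 1) {0..<N} l ((1 - l) / 2 * t) * (cmod (char M (l ^ N * t)))\<^sup>2"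
  proof (induction N)
    case (Suc N)
    have "(cmod (char M (l ^ N * t)))\<^sup>2
        = (cos (l ^ N * t * (1 - l) / 2))\<^sup>2 * (cmod (char M (l ^ Suc N * t)))\<^sup>2"
      by (subst char_bernoulli_convolution[OF conv])
        (simp only: norm_mult power_mult_distrib factor power_Suc mult.assoc)
    with Suc show ?case by (simp add: cosine_product_def ac_simps)
  qed (simp add: cosine_product_def)
  moreover have "(cmod (char M (l ^ N * t)))\<^sup>2 \<le> 1"
    using cmod_char_le_1 by (simp add: abs_square_le_1)
  ultimately show ?thesis
    using cosine_product_nonneg by (metis mult_left_le)
qed

lemma absolutely_continuous_if_char_energy:
  assumes "char_energy l < \<infinity>"
  shows "absolutely_continuous lborel M"
proof (rule absolutely_continuous_if_char_square_integrable[OF real_distribution_axioms])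
  have "(\<integral>\<^sup>+t. ennreal ((cmod (char M t))\<^sup>2) \<partial>lborel) \<le> (\<integral>\<^sup>+t. cosine_limit (\<lambda>_. 1) l ((1 - l) / 2 * t) \<partial>lborel)"
    unfolding cosine_limit_def
    by (intro nn_integral_mono INF_greatest ennreal_leI norm_char_le_cosine_product)
  moreover have "char_energy l = ennreal ((1 - l) / 2) * (\<integral>\<^sup>+t. cosine_limit (\<lambda>_. 1) l ((1 - l) / 2 * t) \<partial>lborel)"
    using nn_integral_real_affine[of "cosine_limit (\<lambda>_. 1) l" "(1 - l) / 2" 0] l by simp
  then have "(\<integral>\<^sup>+t. cosine_limit (\<lambda>_. 1) l ((1 - l) / 2 * t) \<partial>lborel) < \<infinity>"
    using assms l by (auto simp: ennreal_mult_less_top)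
  ultimately show "(\<integral>\<^sup>+t. ennreal ((cmod (char M t))\<^sup>2) \<partial>lborel) < \<infinity>" by (rule le_less_trans)
qed

end

theorem solomyak:
  "AE l in lborel. l \<in> {1/2<..<1} \<longrightarrow> absolutely_continuous lborel (bernoulli_convolution l)"
  using AE_char_energy_finite
proof eventually_elim
  case (elim l)
  show ?case
  proof
    assume range: "l \<in> {1/2<..<1}"
    interpret bernoulli_measure l "bernoulli_convolution l"
      using range by unfold_locales (auto intro: bernoulli_convolution)
    show "absolutely_continuous lborel (bernoulli_convolution l)"
      using elim range by (intro absolutely_continuous_if_char_energy) auto
  qed
qed

theorem corollary1p3:
  shows "(\<forall>l::real. 0 < l \<and> l < 1 \<and> absolutely_continuous lborel (bernoulli_convolution l) \<and> l \<noteq> 1/2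
            \<longrightarrow> \<not> admits_fourier_frame (bernoulli_convolution l)) \<and>
         (AE l in lborel. l \<in> {1/2<..<1} \<longrightarrow> \<not> admits_fourier_frame (bernoulli_convolution l))"
proof
  show first: "\<forall>l::real. 0 < l \<and> l < 1 \<and> absolutely_continuous lborel (bernoulli_convolution l) \<and> l \<noteq> 1/2
            \<longrightarrow> \<not> admits_fourier_frame (bernoulli_convolution l)"
  proof (intro allI impI, elim conjE)
    fix l :: real
    assume range: "0 < l" "l < 1" "l \<noteq> 1/2" and ac: "absolutely_continuous lborel (bernoulli_convolution l)"
    interpret bernoulli_measure l "bernoulli_convolution l"
      using range by unfold_locales (auto intro: bernoulli_convolution)
    have "1/2 < l" using not_absolutely_continuous ac range by force
    then show "\<not> admits_fourier_frame (bernoulli_convolution l)"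
      using ac by (rule not_admits_fourier_frame)
  qed
  show "AE l in lborel. l \<in> {1/2<..<1} \<longrightarrow> \<not> admits_fourier_frame (bernoulli_convolution l)"
    using solomyak by eventually_elim (use first in auto)
qed

end
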